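(* Let $N\ge 2$ and let $f:[0,\infty)\to[0,\infty)$ satisfy $(f_1)$, $(f_2)$, $(f_3)$ (listed in the context). Suppose $f$ is sub-exponential: there is $\beta>0$ such that $C:=\sup_{t\in[0,\infty)} f(t)e^{-\beta t}<\infty$; fix such a $\beta$ and the corresponding $C$. Then there exist $\alpha>0$ and $R_*>0$, depending on $\beta$ and $C$, such that the problem $(P_{\alpha,R_*})$, $$-\Delta_N u=f(u)+\alpha\delta_0\ \text{ in }\mathcal D'(B_{R_*}),\qquad f(u)\in L^\infty_{\rm loc}(\overline B_{R_*}\setminus\{0\})\cap L^1(B_{R_*}),$$ admits a distributional solution.
   Context: $B_R\subset\mathbb R^N$ is the open ball of radius $R$ centred at $0$; $\Delta_N u=\operatorname{div}(|\nabla u|^{N-2}\nabla u)$; $\delta_0$ is the Dirac mass at $0$. $L^\infty_{\rm loc}(\overline B_R\setminus\{0\})$ denotes functions essentially bounded on compact subsets of $\overline B_R\setminus\{0\}$. Standing assumptions on $f$: $(f_1)$ $f$ is locally Hölder continuous on $[0,\infty)$ with some exponent $\theta\in(0,1)$; $(f_2)$ $\liminf_{t\to\infty}f(t)t^{1-N}>0$; $(f_3)$ there is $\kappa>0$ such that $t\mapsto f(t)+\kappa t^{N-1}$ is non-decreasing on $[0,\infty)$. A distributional solution of $(P_{\alpha,R})$ is a nonnegative function $u$ on $B_R$ (so that $f(u)$ is defined), weakly differentiable with $u\in L^1_{\rm loc}(B_R)$, $|\nabla u|\in L^{N-1}_{\rm loc}(B_R)$, with $f(u)\in L^\infty_{\rm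 loc}(\overline B_R\setminus\{0\})\cap L^1(B_R)$ and $\int_{B_R}|\nabla u|^{N-2}\nabla u\cdot\nabla\phi\,dx=\int_{B_R}f(u)\phi\,dx+\alpha\phi(0)$ for all $\phi\in C_0^\infty(B_R)$. *)

theory Defs
  imports "HOL-Analysis.Analysis"
begin

text \<open>
  Functions on an open set \<open>\<Omega>\<close> are represented by total functions whose values
  outside \<open>\<Omega>\<close> are irrelevant.
\<close>

definition locally_holder_on :: "real \<Rightarrow> real set \<Rightarrow> (real \<Rightarrow> real) \<Rightarrow> bool" where
  "locally_holder_on \<theta> S f \<longleftrightarrow>
     (\<forall>K. compact K \<and> K \<subseteq> S \<longrightarrow>
        (\<exists>L. \<forall>s\<in>K. \<forall>t\<in>K. \<bar>f s - f t\<bar> \<le> L * \<bar>s - t\<bar> powr \<theta>))"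

text \<open>
  In the second condition \<open>t powr (1 - real N)\<close> is only relevant for large positive
  \<open>t\<close>; the limes inferior is taken in the extended reals, since it may be infinite.
\<close>

definition admissible_nonlinearity :: "nat \<Rightarrow> (real \<Rightarrow> real) \<Rightarrow> bool" where
  "admissible_nonlinearity N f \<longleftrightarrow>
     f \<in> {0..} \<rightarrow> {0..} \<and>
     (\<exists>\<theta>. 0 < \<theta> \<and> \<theta> < 1 \<and> locally_holder_on \<theta> {0..} f) \<and>
     Liminf at_top (\<lambda>t. ereal (f t * t powr (1 - real N))) > 0 \<and>
     (\<exists>\<kappa>>0. mono_on {0..} (\<lambda>t. f t + \<kappa> * t ^ (N - 1)))"

definition partial_deriv :: "'a::euclidean_space \<Rightarrow> ('a \<Rightarrow> real) \<Rightarrow> 'a \<Rightarrow> real" where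
  "partial_deriv i \<phi> x = frechet_derivative \<phi> (at x) i"

definition gradient :: "('a::euclidean_space \<Rightarrow> real) \<Rightarrow> 'a \<Rightarrow> 'a" where
  "gradient \<phi> x = (\<Sum>i\<in>Basis. partial_deriv i \<phi> x *\<^sub>R i)"

primrec times_cont_differentiable :: "nat \<Rightarrow> ('a::euclidean_space \<Rightarrow> real) \<Rightarrow> bool" where
  "times_cont_differentiable 0 \<phi> \<longleftrightarrow> continuous_on UNIV \<phi>"
| "times_cont_differentiable (Suc k) \<phi> \<longleftrightarrow>
     (\<forall>x. \<phi> differentiable (at x)) \<and>
     (\<forall>i\<in>Basis. times_cont_differentiable k (partial_deriv i \<phi>))"

definition test_functions :: "'a::euclidean_space set \<Rightarrow> ('a \<Rightarrow> real) set" where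
  "test_functions \<Omega> =
     {\<phi>. (\<forall>k. times_cont_differentiable k \<phi>) \<and>
          compact (closure {x. \<phi> x \<noteq> 0}) \<and> closure {x. \<phi> x \<noteq> 0} \<subseteq> \<Omega>}"

definition locally_Lp :: "nat \<Rightarrow> 'a::euclidean_space set \<Rightarrow> ('a \<Rightarrow> 'b::euclidean_space) \<Rightarrow> bool" where
  "locally_Lp p S g \<longleftrightarrow>
     g \<in> borel_measurable (lebesgue_on S) \<and>
     (\<forall>K. compact K \<and> K \<subseteq> S \<longrightarrow> set_integrable lebesgue K (\<lambda>x. norm (g x) ^ p))"

definition locally_Linfty :: "'a::euclidean_space set \<Rightarrow> ('a \<Rightarrow> 'b::euclidean_space) \<Rightarrow> bool" where
  "locally_Linfty S g \<longleftrightarrow>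
     g \<in> borel_measurable (lebesgue_on S) \<and>
     (\<forall>K. compact K \<and> K \<subseteq> S \<longrightarrow> (\<exists>M. AE x in lebesgue. x \<in> K \<longrightarrow> norm (g x) \<le> M))"

definition has_weak_gradient ::
  "('a::euclidean_space \<Rightarrow> real) \<Rightarrow> ('a \<Rightarrow> 'a) \<Rightarrow> 'a set \<Rightarrow> bool" where
  "has_weak_gradient u G \<Omega> \<longleftrightarrow>
     locally_Lp 1 \<Omega> u \<and> locally_Lp 1 \<Omega> G \<and>
     (\<forall>\<phi>\<in>test_functions \<Omega>. \<forall>i\<in>Basis.
        (LINT x:\<Omega>|lebesgue. u x * partial_deriv i \<phi> x) =
        - (LINT x:\<Omega>|lebesgue. (G x \<bullet> i) * \<phi> x))"

text \<open>
  With \<open>N = DIM('a)\<close>, this is the problem \<open>- \<Delta>\<^sub>N u = f(u) + \<alpha> \<delta>\<^sub>0\<close> in the ball of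
  radius \<open>R\<close>. The set \<open>cball 0 R - {0}\<close> meets the complement of the ball
  in a Lebesgue null set, on which the values of \<open>u\<close> play no role because \<open>lebesgue\<close>
  is complete.
\<close>

definition distributional_solution ::
  "(real \<Rightarrow> real) \<Rightarrow> real \<Rightarrow> real \<Rightarrow> ('a::euclidean_space \<Rightarrow> real) \<Rightarrow> bool" where
  "distributional_solution f \<alpha> R u \<longleftrightarrow>
     (\<forall>x\<in>ball 0 R. 0 \<le> u x) \<and>
     locally_Linfty (cball 0 R - {0}) (\<lambda>x. f (u x)) \<and>
     set_integrable lebesgue (ball 0 R) (\<lambda>x. f (u x)) \<and>
     (\<exists>G. has_weak_gradient u G (ball 0 R) \<and>
        locally_Lp (DIM('a) - 1) (ball 0 R) G \<and>
        (\<forall>\<phi>\<in>test_functions (ball 0 R).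
           (LINT x:ball 0 R|lebesgue. norm (G x) ^ (DIM('a) - 2) * (G x \<bullet> gradient \<phi> x)) =
           (LINT x:ball 0 R|lebesgue. f (u x) * \<phi> x) + \<alpha> * \<phi> 0))"

end

theory Submission
  imports Defs "HOL-Complex_Analysis.Great_Picard"
begin

text \<open>
  The solution is radial, \<open>u(x) = U(|x|)\<close>. Integrating the radial equation once gives
  \<open>- r U' = m\<^bsup>1/(N-1)\<^esup>\<close> with \<open>m(r) = a\<^bsup>N-1\<^esup> + \<integral>\<^sub>0\<^sup>r s\<^bsup>N-1\<^esup> f(U(s)) ds\<close>, so that
  \<open>U = - a ln r - w(r)\<close> with \<open>w(0) = 0\<close>, and \<open>f(U) \<le> C e\<^bsup>\<beta>U\<^esup> \<le> C / r\<close> for \<open>a = 1 / \<beta>\<close>. Prescribing \<open>w(0) = 0\<close>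
  instead of a boundary value on the sphere of radius \<open>R\<close> turns the problem into an initial value
  problem at \<open>r = 0\<close> with bounded right hand side, which is solvable by Peano's theorem. As
  \<open>w\<close> is at most linear in \<open>r\<close>, \<open>U\<close> is nonnegative on a small interval that depends on \<open>\<beta>\<close> and \<open>C\<close> only. The Dirac
  mass comes from \<open>m(0) = a\<^bsup>N-1\<^esup>\<close>, by integrating along rays.
\<close>

text \<open>\<open>f\<close> is only Hoelder continuous, so no Lipschitz condition is at hand and
  existence has to come from compactness. Starting at the origin fixes the strength of the
  singularity in advance and leaves nonnegativity of \<open>U\<close> as the only restriction on the
  radius: the mass depends on the dimension and \<beta> alone, and \<open>C\<close> enters only
  through the radius. The choice \<open>a = 1 / \<beta>\<close> gives r^(N-1) f(U) \<le> C r^(N-2),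
  which is bounded for every N \<ge> 2. Every singular quantity on the ball is measured against
  |x|^(1-N), the rate at which |grad u|^(N-1) blows up; this rate is integrable in dimension N.
  Neither weak identity is obtained by cutting out a small ball and estimating boundary terms: the
  equation is integrated along rays that start at 0, and the weak gradient is the limit of
  identities for functions without a singularity.\<close>

section \<open>Peano's theorem for a right-hand side that may be discontinuous at the initial
  time\<close>

lemma bounded_continuous_imp_integrable_on:
  fixes f :: "real \<Rightarrow> 'b::euclidean_space"
  assumes "continuous_on {a<..b} f" "\<And>x. x \<in> {a<..b} \<Longrightarrow> norm (f x) \<le> B"
  shows "f integrable_on {a..b}"
proof -
  have "f integrable_on {a<..b}"
  proof (rule measurable_bounded_by_integrable_imp_integrable[where g = "\<lambda>_. B"])
    show "f \<in> borel_measurable (lebesgue_on {a<..b})"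
      using assms(1) by (rule continuous_imp_measurable_on_sets_lebesgue) simp
    have "(\<lambda>_::real. B) integrable_on {a..b}"
      by (rule integrable_const_ivl)
    then show "(\<lambda>_::real. B) integrable_on {a<..b}"
      by (rule integrable_spike_set) (auto intro: negligible_subset[of "{a}"])
  qed (use assms in auto)
  then show ?thesis
    by (rule integrable_spike_set) (auto intro: negligible_subset[of "{a}"])
qed

lemma norm_integral_diff_le:
  fixes f :: "real \<Rightarrow> 'b::euclidean_space"
  assumes f: "f integrable_on {a..T}" and B: "\<And>x. x \<in> {a..T} \<Longrightarrow> norm (f x) \<le> B"
    and xy: "x \<in> {a..T}" "y \<in> {a..T}"
  shows "norm (integral {a..x} f - integral {a..y} f) \<le> B * \<bar>x - y\<bar>"
proof -
  have *: "norm (integral {a..y} f - integral {a..x} f) \<le> B * (y - x)"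
    if xy: "a \<le> x" "x \<le> y" "y \<le> T" for x y
  proof -
    have int: "f integrable_on {a..y}" "f integrable_on {x..y}"
      using f xy by (auto intro: integrable_subinterval_real)
    have "integral {a..x} f + integral {x..y} f = integral {a..y} f"
      using Henstock_Kurzweil_Integration.integral_combine[OF xy(1,2) int(1)] .
    then have "integral {a..y} f - integral {a..x} f = integral {x..y} f"
      by (simp add: algebra_simps)
    moreover have "norm (integral {x..y} f) \<le> B * (y - x)"
    proof -
      have "0 \<le> B"
        using order_trans[OF norm_ge_zero B[of x]] xy by auto
      then have "norm (integral (cbox x y) f) \<le> B * measure lborel (cbox x y)"
        using int(2) B xy by (intro has_integral_bound[OF _ integrable_integral]) auto
      then show ?thesis
        using xy by simp
    qed
    ultimately show ?thesis by simp
  qed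
  show ?thesis
    using *[of x y] *[of y x] xy by (cases "x \<le> y") (auto simp: norm_minus_commute)
qed

text \<open>Continuity is asked for only after time 0, because the radial system contains a factor
  \<open>1 / t\<close>. The bound on all of \<open>{0..T}\<close> takes the place of continuity at
  0: it makes the right-hand side integrable along every continuous curve.\<close>

context
  fixes F :: "real \<Rightarrow> 'b::euclidean_space \<Rightarrow> 'b" and T B :: real
  assumes T: "0 < T"
    and cont: "continuous_on ({0<..T} \<times> UNIV) (\<lambda>(t, y). F t y)"
    and bnd: "\<And>t y. t \<in> {0..T} \<Longrightarrow> norm (F t y) \<le> B"
begin

lemma nemytskii_integrable_on:
  assumes "continuous_on {0..T} y" "t \<in> {0..T}"
  shows "(\<lambda>s. F s (y s)) integrable_on {0..t}"
proof (rule bounded_continuous_imp_integrable_on)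
  have "continuous_on {0<..t} (\<lambda>s. (s, y s))"
    using assms by (auto intro!: continuous_intros intro: continuous_on_subset)
  then have "continuous_on {0<..t} (\<lambda>s. (\<lambda>(t, y). F t y) (s, y s))"
    by (rule continuous_on_compose2[OF cont]) (use assms in auto)
  then show "continuous_on {0<..t} (\<lambda>s. F s (y s))"
    by simp
  show "norm (F s (y s)) \<le> B" if "s \<in> {0<..t}" for s
    using that assms by (intro bnd) auto
qed

text \<open>The delayed equation determines its solution on successive intervals of length \<delta>.
  Instead of gluing pieces, each iterate is defined for all times, and the one with index
  \<open>k\<close> is final up to time \<open>k * \<delta>\<close>.\<close>

primrec tonelli_iterate :: "real \<Rightarrow> nat \<Rightarrow> real \<Rightarrow> 'b" where
  "tonelli_iterate \<delta> 0 t = 0"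
| "tonelli_iterate \<delta> (Suc k) t = integral {0..max 0 (t - \<delta>)} (\<lambda>s. F s (tonelli_iterate \<delta> k s))"

lemma bound_nonneg: "0 \<le> B"
  using order_trans[OF norm_ge_zero bnd[of 0 0]] T by auto

text \<open>The upper limit \<open>max 0 (t - \<delta>)\<close> is 1-Lipschitz in \<open>t\<close>
  and the integrand is bounded by \<open>B\<close>, so the constant depends neither on
  \<open>k\<close> nor on \<delta>; this is the equicontinuity for Arzela-Ascoli. Induction enters
  because the next integrand is integrable only once the current iterate is known to be
  continuous.\<close>

lemma tonelli_iterate_lipschitz:
  assumes "\<delta> > 0"
  shows "\<forall>s\<in>{0..T}. \<forall>t\<in>{0..T}. norm (tonelli_iterate \<delta> k s - tonelli_iterate \<delta> k t) \<le> B * \<bar>s - t\<bar>"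
proof (induction k)
  case 0
  then show ?case using bound_nonneg by simp
next
  case (Suc k)
  have "continuous_on {0..T} (tonelli_iterate \<delta> k)"
    by (rule lipschitz_on_continuous_on[of B])
      (use Suc bound_nonneg in \<open>auto simp: lipschitz_on_def dist_norm\<close>)
  then have int: "(\<lambda>s. F s (tonelli_iterate \<delta> k s)) integrable_on {0..T}"
    using nemytskii_integrable_on T by auto
  show ?case
  proof (intro ballI)
    fix s t assume st: "s \<in> {0..T}" "t \<in> {0..T}"
    have "norm (tonelli_iterate \<delta> (Suc k) s - tonelli_iterate \<delta> (Suc k) t)
      \<le> B * \<bar>max 0 (s - \<delta>) - max 0 (t - \<delta>)\<bar>"
      unfolding tonelli_iterate.simps
      by (rule norm_integral_diff_le[OF int]) (use st assms bnd in auto)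
    also have "\<dots> \<le> B * \<bar>s - t\<bar>"
      by (intro mult_left_mono bound_nonneg) auto
    finally show "norm (tonelli_iterate \<delta> (Suc k) s - tonelli_iterate \<delta> (Suc k) t) \<le> B * \<bar>s - t\<bar>" .
  qed
qed

text \<open>An iterate at time \<open>t\<close> uses its predecessor only up to
  \<open>t - \<delta>\<close>, so each step extends the range of agreement by one delay. Once
  \<open>k * \<delta>\<close> exceeds \<open>T\<close>, the iterate solves the delayed equation on
  the whole interval.\<close>

lemma tonelli_iterate_stable:
  "\<delta> > 0 \<Longrightarrow> 0 \<le> t \<Longrightarrow> t \<le> real k * \<delta> \<Longrightarrow> tonelli_iterate \<delta> (Suc k) t = tonelli_iterate \<delta> k t"
proof (induction k arbitrary: t)
  case 0
  then show ?case by simp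
next
  case (Suc k)
  have "tonelli_iterate \<delta> (Suc k) s = tonelli_iterate \<delta> k s" if "s \<in> {0..max 0 (t - \<delta>)}" for s
    using that Suc.prems by (intro Suc.IH) (auto simp: algebra_simps max_def split: if_splits)
  then have "integral {0..max 0 (t - \<delta>)} (\<lambda>s. F s (tonelli_iterate \<delta> (Suc k) s))
      = integral {0..max 0 (t - \<delta>)} (\<lambda>s. F s (tonelli_iterate \<delta> k s))"
    by (intro Henstock_Kurzweil_Integration.integral_cong) auto
  then show ?case
    by simp
qed

lemma exists_delayed_solution:
  assumes "\<delta> > 0"
  obtains y where "\<And>s t. s \<in> {0..T} \<Longrightarrow> t \<in> {0..T} \<Longrightarrow> norm (y s - y t) \<le> B * \<bar>s - t\<bar>"
    "\<And>t. t \<in> {0..T} \<Longrightarrow> y t = integral {0..max 0 (t - \<delta>)} (\<lambda>s. F s (y s))"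
proof -
  obtain k where k: "T < real k * \<delta>"
    using reals_Archimedean3[OF assms] by blast
  show ?thesis
  proof (rule that[of "tonelli_iterate \<delta> k"])
    show "tonelli_iterate \<delta> k t = integral {0..max 0 (t - \<delta>)} (\<lambda>s. F s (tonelli_iterate \<delta> k s))"
      if "t \<in> {0..T}" for t
      using tonelli_iterate_stable[OF assms, of t k] that k by simp
  qed (use tonelli_iterate_lipschitz[OF assms, of k] in auto)
qed

text \<open>Tonelli's scheme: solutions of the equation with delay \<open>1/n\<close> are uniformly Lipschitz,
  and the limit of a uniformly convergent subsequence solves the equation without delay.\<close>

theorem peano_caratheodory:
  obtains y where "continuous_on {0..T} y" "y 0 = 0"
    "\<And>t. t \<in> {0<..T} \<Longrightarrow> (y has_vector_derivative F t (y t)) (at t within {0..T})"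
proof -
  define \<delta> where "\<delta> n = inverse (real (Suc n))" for n
  have "\<exists>y. (\<forall>s\<in>{0..T}. \<forall>t\<in>{0..T}. norm (y s - y t) \<le> B * \<bar>s - t\<bar>) \<and>
     (\<forall>t\<in>{0..T}. y t = integral {0..max 0 (t - \<delta> n)} (\<lambda>s. F s (y s)))" for n
    using exists_delayed_solution[of "\<delta> n"] unfolding \<delta>_def by (metis inverse_positive_iff_positive of_nat_0_less_iff zero_less_Suc)
  then obtain Y where
    lip: "\<And>n s t. s \<in> {0..T} \<Longrightarrow> t \<in> {0..T} \<Longrightarrow> norm (Y n s - Y n t) \<le> B * \<bar>s - t\<bar>" and
    Y: "\<And>n t. t \<in> {0..T} \<Longrightarrow> Y n t = integral {0..max 0 (t - \<delta> n)} (\<lambda>s. F s (Y n s))"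
    by metis
  have \<delta>0: "\<delta> n > 0" for n by (simp add: \<delta>_def)
  have Y0: "Y n 0 = 0" for n
    using Y[of 0 n] T \<delta>0[of n] by (simp add: max_def)
  have Ycont: "continuous_on {0..T} (Y n)" for n
    by (rule lipschitz_on_continuous_on[of B])
      (use lip bound_nonneg in \<open>auto simp: lipschitz_on_def dist_norm\<close>)
  obtain y r where ycont: "continuous_on {0..T} y" and r: "strict_mono (r :: nat \<Rightarrow> nat)"
    and lim: "\<And>e. 0 < e \<Longrightarrow> \<exists>N. \<forall>n x. n \<ge> N \<and> x \<in> {0..T} \<longrightarrow> norm (Y (r n) x - y x) < e"
  proof (rule Arzela_Ascoli[of "{0..T}" Y "B * T"])
    show "norm (Y n x) \<le> B * T" if "x \<in> {0..T}" for n x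
    proof -
      have "norm (Y n x - Y n 0) \<le> B * \<bar>x - 0\<bar>"
        using that T by (intro lip) auto
      also have "\<dots> \<le> B * T"
        using that by (intro mult_left_mono bound_nonneg) auto
      finally show ?thesis by (simp add: Y0)
    qed
    show "\<exists>d>0. \<forall>n y. y \<in> {0..T} \<and> norm (x - y) < d \<longrightarrow> norm (Y n x - Y n y) < e"
      if x: "x \<in> {0..T}" and e: "0 < e" for x e
    proof (intro exI[of _ "e / (B + 1)"] conjI allI impI)
      show "0 < e / (B + 1)"
        using e bound_nonneg by simp
      fix n y assume y: "y \<in> {0..T} \<and> norm (x - y) < e / (B + 1)"
      have "norm (Y n x - Y n y) \<le> B * \<bar>x - y\<bar>"
        using x y by (intro lip) auto
      also have "\<dots> \<le> (B + 1) * \<bar>x - y\<bar>"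
        by (intro mult_right_mono) auto
      also have "\<dots> < e"
        using y bound_nonneg by (simp add: field_simps)
      finally show "norm (Y n x - Y n y) < e" .
    qed
  qed auto
  have conv: "(\<lambda>n. Y (r n) t) \<longlonglongrightarrow> y t" if "t \<in> {0..T}" for t
    unfolding LIMSEQ_iff using lim that by blast
  have yint: "y t = integral {0..t} (\<lambda>s. F s (y s))" if t: "t \<in> {0..T}" for t
  proof -
    have "(\<lambda>n. integral {0..t} (\<lambda>s. F s (Y (r n) s))) \<longlonglongrightarrow> integral {0..t} (\<lambda>s. F s (y s))"
    proof (rule dominated_convergence(2)[where h = "\<lambda>_. B"])
      show "(\<lambda>s. F s (Y (r n) s)) integrable_on {0..t}" for n
        by (rule nemytskii_integrable_on[OF Ycont t])
      show "norm (F s (Y (r n) s)) \<le> B" if "s \<in> {0..t}" for n s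
        using that t by (intro bnd) auto
      show "(\<lambda>n. F s (Y (r n) s)) \<longlonglongrightarrow> F s (y s)" if s: "s \<in> {0..t}" for s
      proof (cases "s = 0")
        case True
        have "y 0 = 0"
          using conv[of 0] T by (simp add: Y0 LIMSEQ_const_iff)
        then show ?thesis using True by (simp add: Y0)
      next
        case False
        have "(\<lambda>n. (s, Y (r n) s)) \<longlonglongrightarrow> (s, y s)"
          using s t by (intro tendsto_intros conv) auto
        then have "(\<lambda>n. (\<lambda>(t, y). F t y) (s, Y (r n) s)) \<longlonglongrightarrow> (\<lambda>(t, y). F t y) (s, y s)"
          by (rule continuous_on_tendsto_compose[OF cont]) (use False s t in auto)
        then show ?thesis by simp
      qed
    qed (rule integrable_const_ivl)
    \<comment> \<open>The delay removes an interval of length at most \<open>\<delta> (r n)\<close>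
      from the integral, which costs at most \<open>B * \<delta> (r n)\<close>.\<close>
    moreover have "(\<lambda>n. Y (r n) t - integral {0..t} (\<lambda>s. F s (Y (r n) s))) \<longlonglongrightarrow> 0"
    proof (rule Lim_null_comparison)
      show "\<forall>\<^sub>F n in sequentially. norm (Y (r n) t - integral {0..t} (\<lambda>s. F s (Y (r n) s))) \<le> B * \<delta> (r n)"
      proof (intro always_eventually allI)
        fix n
        have "norm (integral {0..max 0 (t - \<delta> (r n))} (\<lambda>s. F s (Y (r n) s)) - integral {0..t} (\<lambda>s. F s (Y (r n) s)))
            \<le> B * \<bar>max 0 (t - \<delta> (r n)) - t\<bar>"
          by (rule norm_integral_diff_le[of _ 0 T])
            (use T t \<delta>0[of "r n"] bnd in \<open>auto intro: nemytskii_integrable_on[OF Ycont]\<close>)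
        also have "\<dots> \<le> B * \<delta> (r n)"
          using t \<delta>0[of "r n"] by (intro mult_left_mono bound_nonneg) auto
        finally show "norm (Y (r n) t - integral {0..t} (\<lambda>s. F s (Y (r n) s))) \<le> B * \<delta> (r n)"
          using Y[OF t, of "r n"] by simp
      qed
      have "(\<lambda>n. \<delta> (r n)) \<longlonglongrightarrow> 0"
        using LIMSEQ_subseq_LIMSEQ[OF LIMSEQ_inverse_real_of_nat r] by (simp add: \<delta>_def o_def)
      then show "(\<lambda>n. B * \<delta> (r n)) \<longlonglongrightarrow> 0"
        by (rule tendsto_mult_right_zero)
    qed
    ultimately have "y t - integral {0..t} (\<lambda>s. F s (y s)) = 0"
      using LIMSEQ_unique[OF tendsto_diff[OF conv[OF t]]] by blast
    then show ?thesis
      by simp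
  qed
  show ?thesis
  proof
    show "continuous_on {0..T} y" by fact
    show "y 0 = 0" using yint[of 0] T by simp
    fix t assume t: "t \<in> {0<..T}"
    \<comment> \<open>For \<open>t > 0\<close> the endpoint 0 does not affect the filter, so
      continuity on \<open>{0<..T}\<close> is enough for the fundamental theorem although the
      integral starts at 0.\<close>
    have at_t: "at t within {0..T} = at t within {0<..T}"
      by (rule at_within_nhd[of t "{0<..}"]) (use t in auto)
    have "continuous_on {0<..T} (\<lambda>s. (s, y s))"
      using ycont by (auto intro!: continuous_intros intro: continuous_on_subset)
    then have "continuous_on {0<..T} (\<lambda>s. (\<lambda>(t, y). F t y) (s, y s))"
      by (rule continuous_on_compose2[OF cont]) auto
    then have "continuous (at t within {0<..T}) (\<lambda>s. F s (y s))"
      using t by (simp add: continuous_on_eq_continuous_within)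
    then have "continuous (at t within {0..T}) (\<lambda>s. F s (y s))"
      unfolding at_t .
    then have "((\<lambda>t. integral {0..t} (\<lambda>s. F s (y s))) has_vector_derivative F t (y t)) (at t within {0..T})"
      using integral_has_vector_derivative_continuous_at[of "\<lambda>s. F s (y s)" 0 T t "{}"]
        nemytskii_integrable_on[OF ycont, of T] t T by simp
    then show "(y has_vector_derivative F t (y t)) (at t within {0..T})"
      by (rule has_vector_derivative_transform[rotated 2]) (use t yint in auto)
  qed
qed

end

section \<open>The radial initial value problem\<close>

text \<open>For the root y \<ge> a one has y a^(n-1) \<le> y^n = a^n + x, and subtracting a^n gives
  the linear bound. Linearity in \<open>x\<close> is what compensates the division by
  \<open>t\<close> in the equation for \<open>w\<close>.\<close>

lemma root_power_add_le:
  assumes "n > 0" "a > 0" "0 \<le> x"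
  shows "a \<le> root n (a ^ n + x)" "root n (a ^ n + x) - a \<le> x / a ^ (n - 1)"
proof -
  define y where "y = root n (a ^ n + x)"
  have y: "y ^ n = a ^ n + x"
    unfolding y_def using assms by (intro real_root_pow_pos2) auto
  have "root n (a ^ n) \<le> y"
    unfolding y_def using assms by (intro real_root_le_mono) auto
  then have ay: "a \<le> y"
    using assms by (simp add: real_root_power_cancel)
  have pow: "z ^ n = z * z ^ (n - 1)" for z :: real
    using assms(1) by (metis Suc_diff_1 power_Suc)
  have "y * a ^ (n - 1) \<le> y ^ n"
    unfolding pow[of y] using ay assms by (intro mult_left_mono power_mono) auto
  then have "(y - a) * a ^ (n - 1) \<le> x"
    using y pow[of a] by (simp add: algebra_simps)
  then show "root n (a ^ n + x) - a \<le> x / a ^ (n - 1)"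
    using assms by (simp add: y_def field_simps)
  show "a \<le> root n (a ^ n + x)"
    using ay by (simp add: y_def)
qed

text \<open>With \<open>n = N - 1\<close>, integrating the radial equation once turns it into the first order system
  \<open>m' = r\<^sup>n f(U)\<close>, \<open>U' = - m\<^bsup>1/n\<^esup> / r\<close>, in which \<open>m(0) = a\<^sup>n\<close> is the mass of the singularity.
  It is solved for \<open>m - a\<^sup>n\<close> and \<open>w = - a ln r - U\<close>, which both vanish at 0; truncating them to
  their a priori ranges keeps the right hand side bounded.\<close>

theorem exists_radial_profile:
  fixes f :: "real \<Rightarrow> real" and a C :: real and n :: nat
  assumes n: "n > 0" and a: "a > 0"
    and f_cont: "continuous_on {0..} f" and f_nonneg: "\<And>t. 0 \<le> t \<Longrightarrow> 0 \<le> f t"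
    and f_le: "\<And>t. 0 \<le> t \<Longrightarrow> f t \<le> C * exp (t / a)"
  obtains m U where
    "continuous_on {0..1} m" "m 0 = a ^ n"
    "\<And>r. r \<in> {0..1} \<Longrightarrow> a ^ n \<le> m r"
    "\<And>r. r \<in> {0..1} \<Longrightarrow> m r \<le> a ^ n + C"
    "\<And>r. r \<in> {0<..<1} \<Longrightarrow> (m has_real_derivative r ^ n * f (max 0 (U r))) (at r)"
    "\<And>r. r \<in> {0<..<1} \<Longrightarrow> (U has_real_derivative - root n (m r) / r) (at r)"
    "\<And>r. r \<in> {0<..1} \<Longrightarrow> U r \<le> - a * ln r"
    "\<And>r. r \<in> {0<..1} \<Longrightarrow> - a * ln r - C / a ^ (n - 1) * r \<le> U r"
proof -
  have C: "0 \<le> C"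
    using f_nonneg[of 0] f_le[of 0] by simp
  \<comment> \<open>\<open>U\<close> can become negative before r = 1, where nothing is known about
    \<open>f\<close>; nonnegativity is recovered later by shrinking the radius.\<close>
  define g where "g t = f (max 0 t)" for t
  have g_cont: "continuous_on UNIV g"
    unfolding g_def by (rule continuous_on_compose2[OF f_cont]) (auto intro!: continuous_intros)
  \<comment> \<open>\<open>max 0 w\<close> keeps the argument of \<open>g\<close> at most - a ln t,
    where the exponential bound yields C / t. In \<open>H\<close>, \<open>min (C * t)\<close> makes
    the numerator O(t), and the outer \<open>max 0\<close> keeps the radicand at least
    \<open>a ^ n\<close>.\<close>
  define G where "G t w = t ^ n * g (- a * ln t - max 0 w)" for t w
  define H where "H t p = (root n (a ^ n + max 0 (min (C * t) p)) - a) / t" for t p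
  define F where "F t y = (G t (snd y), H t (fst y))" for t and y :: "real \<times> real"
  define K where "K = C / a ^ (n - 1)"
  have G: "0 \<le> G t w \<and> G t w \<le> C" if t: "t \<in> {0..1}" for t w
  proof (cases "t = 0")
    case True
    then show ?thesis using n C by (simp add: G_def zero_power)
  next
    case False
    with t have t: "0 < t" "t \<le> 1" by auto
    define s where "s = max 0 (- a * ln t - max 0 w)"
    have "ln t \<le> 0" using t by simp
    then have "a * ln t \<le> 0" using a by (simp add: mult_le_0_iff)
    then have s: "0 \<le> s" "s \<le> - a * ln t"
      by (auto simp: s_def)
    have "f s \<le> C * exp (s / a)"
      using s by (intro f_le)
    \<comment> \<open>The factor \<open>a\<close> cancels against the exponent, leaving exp (- ln t)
      = 1 / t; one of the \<open>n\<close> factors \<open>t\<close> absorbs this, which is where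
      \<open>n > 0\<close> is used.\<close>
    also have "s / a \<le> - ln t"
      using s a by (simp add: field_simps)
    then have "C * exp (s / a) \<le> C * exp (- ln t)"
      using C by (intro mult_left_mono) auto
    also have "\<dots> = C / t"
      using t by (simp add: exp_minus field_simps)
    finally have "t ^ n * f s \<le> t ^ n * (C / t)"
      using t by (intro mult_left_mono) auto
    also have "\<dots> = t ^ (n - 1) * C"
      using t n by (cases n) auto
    also have "\<dots> \<le> 1 * C"
      using t C by (intro mult_right_mono power_le_one) auto
    finally have "t ^ n * f s \<le> C" by simp
    moreover have "0 \<le> t ^ n * f s"
      using t s f_nonneg by simp
    ultimately show ?thesis
      by (simp add: G_def g_def s_def)
  qed
  have H: "0 \<le> H t p \<and> H t p \<le> K" if t: "t \<in> {0..1}" for t p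
  proof (cases "t = 0")
    \<comment> \<open>Division by zero yields 0, so \<open>H 0 p = 0\<close> and the bound extends
      to the initial time.\<close>
    case True
    then show ?thesis using a C by (simp add: H_def K_def)
  next
    case False
    with t have t: "0 < t" "t \<le> 1" by auto
    define x where "x = max 0 (min (C * t) p)"
    have x: "0 \<le> x" "x \<le> C * t"
      using t C by (auto simp: x_def)
    note root_power_add_le[OF n a x(1)]
    moreover have "x / a ^ (n - 1) \<le> K * t"
      using x a by (simp add: K_def field_simps)
    ultimately show ?thesis
      using t by (auto simp: H_def x_def[symmetric] field_simps)
  qed
  have contF: "continuous_on ({0<..1} \<times> UNIV) (\<lambda>(t, y). F t y)"
    unfolding F_def G_def H_def case_prod_beta
    by (intro continuous_intros continuous_on_compose2[OF g_cont]) auto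
  have bndF: "norm (F t y) \<le> C + K" if "t \<in> {0..1}" for t y
  proof -
    have "norm (F t y) \<le> norm (G t (snd y)) + norm (H t (fst y))"
      unfolding F_def by (rule norm_Pair_le)
    then show ?thesis
      using G[OF that, of "snd y"] H[OF that, of "fst y"] by auto
  qed
  obtain y where y_cont: "continuous_on {0..1} y" and y0: "y 0 = 0"
    and y_der: "\<And>t. t \<in> {0<..1} \<Longrightarrow> (y has_vector_derivative F t (y t)) (at t within {0..1})"
    using peano_caratheodory[OF zero_less_one contF bndF] by blast
  define p where "p t = fst (y t)" for t
  define w where "w t = snd (y t)" for t
  have der: "(p has_real_derivative G t (w t)) (at t)" "(w has_real_derivative H t (p t)) (at t)"
    if t: "t \<in> {0<..<1}" for t
  proof -
    have "at t within {0..1} = at t"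
      using t by (intro at_within_interior) auto
    then have "(y has_derivative (\<lambda>h. h *\<^sub>R F t (y t))) (at t)"
      using y_der[of t] t by (simp add: has_vector_derivative_def)
    then have "(p has_derivative (\<lambda>h. fst (h *\<^sub>R F t (y t)))) (at t)"
      "(w has_derivative (\<lambda>h. snd (h *\<^sub>R F t (y t)))) (at t)"
      unfolding p_def w_def by (intro has_derivative_fst has_derivative_snd; assumption)+
    then show "(p has_real_derivative G t (w t)) (at t)" "(w has_real_derivative H t (p t)) (at t)"
      by (auto simp: F_def has_field_derivative_def p_def w_def mult_commute_abs)
  qed
  have cont: "continuous_on {0..1} p" "continuous_on {0..1} w"
    unfolding p_def w_def using y_cont by (auto intro!: continuous_intros)
  have zero: "p 0 = 0" "w 0 = 0"
    using y0 by (auto simp: p_def w_def)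
  \<comment> \<open>The a priori ranges follow from the mean value theorem, because the truncated
    right-hand sides lie in \<open>[0, C]\<close> and \<open>[0, K]\<close> for every state.\<close>
  have between: "0 \<le> q r \<and> q r \<le> L * r"
    if "r \<in> {0..1}" "continuous_on {0..1} q" "q 0 = 0" "\<And>t. t \<in> {0<..<1} \<Longrightarrow> (q has_real_derivative q' t) (at t)"
      "\<And>t. t \<in> {0<..<1} \<Longrightarrow> 0 \<le> q' t \<and> q' t \<le> L" for q q' :: "real \<Rightarrow> real" and r L
  proof (cases "r = 0")
    case False
    then have r: "0 < r" "r \<le> 1" using that by auto
    have "\<exists>z. 0 < z \<and> z < r \<and> q r - q 0 = q' z * (r - 0)"
    proof (rule mvt[of 0 r q "\<lambda>z. (*) (q' z)"])
      show "continuous_on {0..r} q"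
        using r by (intro continuous_on_subset[OF that(2)]) auto
      show "(q has_derivative (*) (q' z)) (at z)" if "0 < z" "z < r" for z
        using r that \<open>\<And>t. t \<in> {0<..<1} \<Longrightarrow> (q has_real_derivative q' t) (at t)\<close>[of z]
        by (simp add: has_field_derivative_def)
    qed (use r in auto)
    then obtain z where "0 < z" "z < r" "q r = r * q' z"
      using \<open>q 0 = 0\<close> by (auto simp: mult.commute)
    moreover have "0 \<le> q' z \<and> q' z \<le> L"
      using calculation r by (intro that(5)) auto
    ultimately show ?thesis
      using r by (simp add: mult.commute)
  qed (use that in auto)
  have p: "0 \<le> p r \<and> p r \<le> C * r" if "r \<in> {0..1}" for r
    by (rule between[OF that cont(1) zero(1) der(1)]) (use G in auto)
  have w: "0 \<le> w r \<and> w r \<le> K * r" if "r \<in> {0..1}" for r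
    by (rule between[OF that cont(2) zero(2) der(2)]) (use H in auto)
  define m where "m r = a ^ n + p r" for r
  define U where "U r = - a * ln r - w r" for r
  show ?thesis
  proof (rule that[of m U])
    show "continuous_on {0..1} m"
      unfolding m_def by (intro continuous_intros cont)
    show "m 0 = a ^ n"
      by (simp add: m_def zero)
    fix r :: real
    show "a ^ n \<le> m r" if "r \<in> {0..1}"
      using p[OF that] by (simp add: m_def)
    show "m r \<le> a ^ n + C" if "r \<in> {0..1}"
    proof -
      have "C * r \<le> C * 1" using that C by (intro mult_left_mono) auto
      then show ?thesis using p[OF that] by (simp add: m_def)
    qed
    show "U r \<le> - a * ln r" if "r \<in> {0<..1}"
      using w[of r] that by (simp add: U_def)
    show "- a * ln r - C / a ^ (n - 1) * r \<le> U r" if "r \<in> {0<..1}"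
      using w[of r] that by (simp add: U_def K_def)
    assume r: "r \<in> {0<..<1}"
    \<comment> \<open>The ranges just obtained are exactly the truncation ranges, so the solution
      satisfies the original system.\<close>
    then have "max 0 (w r) = w r" "max 0 (min (C * r) (p r)) = p r"
      using p[of r] w[of r] by auto
    then have GH: "G r (w r) = r ^ n * f (max 0 (U r))" "H r (p r) = (root n (m r) - a) / r"
      by (auto simp: G_def H_def g_def U_def m_def)
    show "(m has_real_derivative r ^ n * f (max 0 (U r))) (at r)"
      unfolding m_def using der(1)[OF r] GH(1) by (auto intro!: derivative_eq_intros)
    have "((\<lambda>r. - a * ln r - w r) has_real_derivative - a * (1 / r) - H r (p r)) (at r)"
      using r by (auto intro!: derivative_eq_intros der(2))
    moreover have "- a * (1 / r) - H r (p r) = - root n (m r) / r"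
      using r by (simp add: GH(2) field_simps)
    ultimately show "(U has_real_derivative - root n (m r) / r) (at r)"
      by (simp add: U_def[abs_def])
  qed
qed

section \<open>Integration along rays\<close>

text \<open>For y \<noteq> 0 the density N |y|^N / s^(N+1) on s > |y| has integral 1. Substituting y
  = s x, with Jacobian s^N, turns it into this weight and the condition s > |y| into |x| <
  1.\<close>

definition ray_weight :: "'a::euclidean_space \<Rightarrow> real \<Rightarrow> real" where
  "ray_weight x s = (if norm x < 1 \<and> 0 < s then real DIM('a) * s ^ (DIM('a) - 1) * norm x ^ DIM('a) else 0)"

lemma ray_weight_nonneg: "0 \<le> ray_weight x s"
  by (auto simp: ray_weight_def indicator_def)

lemma borel_measurable_ray_weight [measurable]:
  "(\<lambda>(x, s). ray_weight x s) \<in> borel_measurable (borel \<Otimes>\<^sub>M borel)"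
  unfolding ray_weight_def by measurable

lemma nn_integral_scale:
  fixes h :: "'a::euclidean_space \<Rightarrow> ennreal"
  assumes [measurable]: "h \<in> borel_measurable borel" and c: "c > 0"
  shows "(\<integral>\<^sup>+x. h x \<partial>lborel) = (\<integral>\<^sup>+x. ennreal (c ^ DIM('a)) * h (c *\<^sub>R x) \<partial>lborel)"
proof -
  have "(\<integral>\<^sup>+x. h x \<partial>lborel) = (\<integral>\<^sup>+x. h x \<partial>density (distr lborel borel (\<lambda>x::'a. 0 + c *\<^sub>R x)) (\<lambda>_. \<bar>c\<bar>^DIM('a)))"
    using lborel_affine[of c "0::'a"] c by simp
  also have "\<dots> = (\<integral>\<^sup>+x. ennreal (c ^ DIM('a)) * h (c *\<^sub>R x) \<partial>lborel)"
    using c by (simp add: nn_integral_density nn_integral_distr)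
  finally show ?thesis .
qed

lemma nn_integral_inverse_power_atLeast:
  fixes a :: real
  assumes a: "a > 0" and n: "n > 0"
  shows "(\<integral>\<^sup>+s. ennreal (real n / s ^ Suc n) * indicator {a..} s \<partial>lborel) = ennreal (1 / a ^ n)"
proof -
  have "(\<integral>\<^sup>+s. ennreal (real n / s ^ Suc n) * indicator {a..} s \<partial>lborel) = ennreal (0 - (- (1 / a ^ n)))"
  proof (rule nn_integral_FTC_atLeast)
    show "((\<lambda>s. - (1 / s ^ n)) has_real_derivative real n / s ^ Suc n) (at s)" if "a \<le> s" for s
      using that a n
      by (auto intro!: derivative_eq_intros simp: divide_simps)
        (cases n; simp add: power_add [symmetric] mult_ac)
    show "((\<lambda>s::real. - (1 / s ^ n)) \<longlongrightarrow> 0) at_top"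
    proof -
      have "((\<lambda>s::real. - inverse (s ^ n)) \<longlongrightarrow> - 0) at_top"
        by (intro tendsto_minus tendsto_inverse_0_at_top filterlim_pow_at_top n filterlim_ident)
      then show ?thesis by (simp add: inverse_eq_divide)
    qed
  qed (use a in auto)
  then show ?thesis by simp
qed

text \<open>Multiply the integrand at \<open>y\<close> by 1 = integral of \<open>k y s\<close> over
  \<open>s\<close>, exchange the integrals, and rescale y = s x separately for each
  \<open>s\<close>.\<close>

lemma nn_integral_rays:
  fixes h :: "'a::euclidean_space \<Rightarrow> ennreal"
  assumes [measurable]: "h \<in> borel_measurable borel"
  shows "(\<integral>\<^sup>+y. h y \<partial>lborel) = (\<integral>\<^sup>+(x, s). ennreal (ray_weight x s) * h (s *\<^sub>R x) \<partial>(lborel \<Otimes>\<^sub>M lborel))"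
proof -
  let ?N = "DIM('a)"
  define k :: "'a \<Rightarrow> real \<Rightarrow> ennreal" where
    "k y s = ennreal (norm y ^ ?N) * (if norm y < s then ennreal (real ?N / s ^ Suc ?N) else 0)" for y s
  have [measurable]: "(\<lambda>(y, s). k y s) \<in> borel_measurable (borel \<Otimes>\<^sub>M borel)"
    unfolding k_def by measurable
  have inner: "(\<integral>\<^sup>+x. ennreal (ray_weight x s) * h (s *\<^sub>R x) \<partial>lborel) = (\<integral>\<^sup>+y. k y s * h y \<partial>lborel)" for s
  proof (cases "s > 0")
    case True
    have "(\<integral>\<^sup>+x. ennreal (ray_weight x s) * h (s *\<^sub>R x) \<partial>lborel) =
       (\<integral>\<^sup>+y. ennreal ((1 / s) ^ ?N) * (ennreal (ray_weight ((1 / s) *\<^sub>R y) s) * h (s *\<^sub>R (1 / s) *\<^sub>R y)) \<partial>lborel)"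
      by (rule nn_integral_scale) (use True in auto)
    also have "\<dots> = (\<integral>\<^sup>+y. k y s * h y \<partial>lborel)"
    proof (rule nn_integral_cong)
      fix y :: 'a
      have "(1 / s) ^ ?N * ray_weight ((1 / s) *\<^sub>R y) s = norm y ^ ?N * (real ?N / s ^ Suc ?N) * indicator {norm y<..} s"
      proof (cases "norm y < s")
        case True
        have "s ^ ?N = s * s ^ (?N - 1)"
          using DIM_positive[where 'a='a] by (metis Suc_diff_1 power_Suc)
        then show ?thesis
          using True \<open>s > 0\<close> by (simp add: ray_weight_def field_simps power_mult_distrib)
      next
        case False
        then show ?thesis using \<open>s > 0\<close> by (simp add: ray_weight_def field_simps)
      qed
      moreover have "ennreal ((1 / s) ^ ?N) * ennreal (ray_weight ((1 / s) *\<^sub>R y) s) = ennreal ((1 / s) ^ ?N * ray_weight ((1 / s) *\<^sub>R y) s)"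
        using True by (simp add: ennreal_mult ray_weight_nonneg)
      moreover have "k y s = ennreal (norm y ^ ?N * (real ?N / s ^ Suc ?N) * indicator {norm y<..} s)"
        using True by (auto simp: k_def ennreal_mult[symmetric])
      ultimately have "ennreal ((1 / s) ^ ?N) * ennreal (ray_weight ((1 / s) *\<^sub>R y) s) = k y s"
        by simp
      then show "ennreal ((1 / s) ^ ?N) * (ennreal (ray_weight ((1 / s) *\<^sub>R y) s) * h (s *\<^sub>R (1 / s) *\<^sub>R y)) = k y s * h y"
        using True by (simp add: mult.assoc[symmetric])
    qed
    finally show ?thesis .
  next
    case False
    then have "\<not> norm y < s" for y :: 'a
      using norm_ge_zero[of y] by linarith
    then have "k y s = 0" for y
      by (simp add: k_def)
    then show ?thesis
      using False by (simp add: ray_weight_def)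
  qed
  have outer: "(\<integral>\<^sup>+s. k y s \<partial>lborel) = 1" if "y \<noteq> 0" for y
  proof -
    have "(\<integral>\<^sup>+s. k y s \<partial>lborel) = ennreal (norm y ^ ?N) * (\<integral>\<^sup>+s. (if norm y < s then ennreal (real ?N / s ^ Suc ?N) else 0) \<partial>lborel)"
      unfolding k_def by (rule nn_integral_cmult) measurable
    also have "(\<integral>\<^sup>+s. (if norm y < s then ennreal (real ?N / s ^ Suc ?N) else 0) \<partial>lborel)
       = (\<integral>\<^sup>+s. ennreal (real ?N / s ^ Suc ?N) * indicator {norm y..} s \<partial>lborel)"
      using AE_lborel_singleton[of "norm y"]
      by (intro nn_integral_cong_AE) (auto simp: indicator_def elim!: eventually_mono)
    also have "\<dots> = ennreal (1 / norm y ^ ?N)"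
      by (rule nn_integral_inverse_power_atLeast) (use that in auto)
    also have "ennreal (norm y ^ ?N) * \<dots> = 1"
      using that by (simp add: ennreal_mult[symmetric])
    finally show ?thesis .
  qed
  have "(\<integral>\<^sup>+(x, s). ennreal (ray_weight x s) * h (s *\<^sub>R x) \<partial>(lborel \<Otimes>\<^sub>M lborel))
      = (\<integral>\<^sup>+s. (\<integral>\<^sup>+x. ennreal (ray_weight x s) * h (s *\<^sub>R x) \<partial>lborel) \<partial>lborel)"
    by (subst lborel_pair.nn_integral_snd[symmetric]) (auto simp: case_prod_beta)
  also have "\<dots> = (\<integral>\<^sup>+s. (\<integral>\<^sup>+y. k y s * h y \<partial>lborel) \<partial>lborel)"
    by (simp add: inner)
  also have "\<dots> = (\<integral>\<^sup>+y. (\<integral>\<^sup>+s. k y s * h y \<partial>lborel) \<partial>lborel)"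
    by (rule lborel_pair.Fubini') measurable
  also have "\<dots> = (\<integral>\<^sup>+y. (\<integral>\<^sup>+s. k y s \<partial>lborel) * h y \<partial>lborel)"
    by (intro nn_integral_cong nn_integral_multc) measurable
  also have "\<dots> = (\<integral>\<^sup>+y. h y \<partial>lborel)"
    using AE_lborel_singleton[of "0::'a"]
    by (intro nn_integral_cong_AE) (auto simp: outer elim!: eventually_mono)
  finally show ?thesis by simp
qed

text \<open>As an equality of measures, the formula passes to signed integrands and to integrability
  through the general rules for image measures and densities.\<close>

lemma lborel_eq_distr_rays:
  "(lborel :: 'a::euclidean_space measure) =
     distr (density (lborel \<Otimes>\<^sub>M lborel) (\<lambda>(x, s). ennreal (ray_weight x s))) borel (\<lambda>(x, s). s *\<^sub>R x)"
  (is "_ = ?M")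
proof (rule measure_eqI)
  fix A :: "'a set" assume "A \<in> sets lborel"
  then have [measurable]: "A \<in> sets borel" by simp
  have "emeasure lborel A = (\<integral>\<^sup>+y. indicator A y \<partial>lborel)"
    by simp
  also have "\<dots> = (\<integral>\<^sup>+(x, s). ennreal (ray_weight x s) * indicator A (s *\<^sub>R x) \<partial>(lborel \<Otimes>\<^sub>M lborel))"
    by (rule nn_integral_rays) measurable
  also have "\<dots> = (\<integral>\<^sup>+y. indicator A y \<partial>?M)"
    by (subst nn_integral_distr, simp, simp, subst nn_integral_density) (auto simp: split_beta')
  also have "\<dots> = emeasure ?M A"
    by (rule nn_integral_indicator) simp
  finally show "emeasure lborel A = emeasure ?M A" .
qed simp

text \<open>Polar coordinates without a surface measure: the directions are averaged over the unit ball
  instead of the unit sphere.\<close>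

lemma integral_rays_const:
  fixes h :: "'a::euclidean_space \<Rightarrow> real"
  assumes h: "integrable lborel h"
    and rays: "\<And>x. x \<noteq> 0 \<Longrightarrow> norm x < 1 \<Longrightarrow> ((\<lambda>s. ray_weight x s * h (s *\<^sub>R x)) has_integral I) UNIV"
  shows "(\<integral>y. h y \<partial>lborel) = I * measure lborel (ball (0::'a) 1)"
proof -
  have [measurable]: "h \<in> borel_measurable borel"
    using h by simp
  have eq: "(\<integral>y. h y \<partial>lborel) = (\<integral>(x, s). ray_weight x s * h (s *\<^sub>R x) \<partial>(lborel \<Otimes>\<^sub>M lborel))"
    by (subst lborel_eq_distr_rays, subst integral_distr, simp, simp,
        subst case_prod_unfold, subst integral_density)
      (auto simp: ray_weight_nonneg split_beta')
  have int: "integrable (lborel \<Otimes>\<^sub>M lborel) (\<lambda>(x, s). ray_weight x s * h (s *\<^sub>R x))"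
    using h
    by (subst (asm) lborel_eq_distr_rays, subst (asm) integrable_distr_eq, simp, simp,
        subst (asm) case_prod_unfold, subst (asm) integrable_density)
      (auto simp: ray_weight_nonneg split_beta')
  have "AE x in lborel. (\<integral>s. ray_weight x s * h (s *\<^sub>R x) \<partial>lborel) = indicator (ball 0 1) x * I"
    using lborel_pair.AE_integrable_fst'[OF int] AE_lborel_singleton[of "0::'a"]
  proof eventually_elim
    case (elim x)
    show ?case
    proof (cases "norm x < 1")
      case True
      \<comment> \<open>By Fubini almost every ray integrand is Lebesgue integrable, so its Lebesgue
        integral agrees with the gauge integral \<open>I\<close> supplied by the hypothesis.\<close>
      have "((\<lambda>s. ray_weight x s * h (s *\<^sub>R x)) has_integral (\<integral>s. ray_weight x s * h (s *\<^sub>R x) \<partial>lborel)) UNIV"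
        using elim(1) by (intro has_integral_integral_lborel) simp
      then have "(\<integral>s. ray_weight x s * h (s *\<^sub>R x) \<partial>lborel) = I"
        by (rule has_integral_unique[OF _ rays[OF elim(2) True]])
      then show ?thesis
        using True by simp
    next
      case False
      then show ?thesis by (simp add: ray_weight_def)
    qed
  qed
  moreover have [measurable]: "ball (0::'a) 1 \<in> sets borel"
    by simp
  ultimately have "(\<integral>x. (\<integral>s. ray_weight x s * h (s *\<^sub>R x) \<partial>lborel) \<partial>lborel) = (\<integral>x. indicator (ball (0::'a) 1) x * I \<partial>lborel)"
    by (intro integral_cong_AE) measurable
  moreover have "(\<integral>y. h y \<partial>lborel) = (\<integral>x. (\<integral>s. ray_weight x s * h (s *\<^sub>R x) \<partial>lborel) \<partial>lborel)"
    using lborel_pair.integral_fst'[OF int] unfolding eq by simp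
  ultimately show ?thesis
    by (simp add: mult.commute)
qed

text \<open>On the ray through \<open>x\<close> the weight N s^(N-1) |x|^N cancels the singularity
  (s |x|)^(1-N) and leaves the constant N |x| on an interval of length R / |x|. Each ray thus
  contributes at most N R.\<close>

lemma integrable_inverse_norm_power:
  assumes "R > 0"
  shows "set_integrable lborel (ball (0::'a::euclidean_space) R) (\<lambda>x. 1 / norm x ^ (DIM('a) - 1))"
  unfolding set_integrable_def
proof (rule integrableI_nonneg)
  let ?N = "DIM('a)"
  let ?h = "\<lambda>x::'a. indicat_real (ball 0 R) x *\<^sub>R (1 / norm x ^ (?N - 1))"
  have [measurable]: "ball (0::'a) R \<in> sets borel"
    by simp
  show [measurable]: "?h \<in> borel_measurable lborel"
    by measurable
  show "AE x in lborel. 0 \<le> ?h x"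
    by simp
  have inner: "(\<integral>\<^sup>+s. ennreal (ray_weight x s) * ennreal (?h (s *\<^sub>R x)) \<partial>lborel) \<le>
      ennreal (real ?N * R) * indicator (ball 0 1) x" if x: "x \<noteq> 0" for x :: 'a
  proof -
    have "(\<integral>\<^sup>+s. ennreal (ray_weight x s) * ennreal (?h (s *\<^sub>R x)) \<partial>lborel) \<le>
       (\<integral>\<^sup>+s. ennreal (real ?N * norm x * indicator (ball 0 1) x) * indicator {0..R / norm x} s \<partial>lborel)"
    proof (rule nn_integral_mono)
      fix s :: real
      show "ennreal (ray_weight x s) * ennreal (?h (s *\<^sub>R x)) \<le>
        ennreal (real ?N * norm x * indicator (ball 0 1) x) * indicator {0..R / norm x} s"
      proof (cases "s > 0 \<and> s * norm x < R \<and> norm x < 1")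
        case True
        have "norm x ^ ?N = norm x * norm x ^ (?N - 1)"
          using DIM_positive[where 'a='a] by (metis Suc_diff_1 power_Suc)
        then have "ray_weight x s * ?h (s *\<^sub>R x) = real ?N * norm x"
          using True x by (simp add: ray_weight_def field_simps power_mult_distrib)
        then show ?thesis
          using True x by (simp add: ennreal_mult[symmetric] ray_weight_nonneg indicator_def field_simps)
      next
        case False
        then have "ray_weight x s * ?h (s *\<^sub>R x) = 0"
          by (auto simp: ray_weight_def indicator_def)
        then have *: "ennreal (ray_weight x s) * ennreal (?h (s *\<^sub>R x)) = 0"
          by (subst ennreal_mult[symmetric]) (auto simp: ray_weight_nonneg)
        show ?thesis unfolding * by simp
      qed
    qed
    also have "\<dots> = ennreal (real ?N * norm x * indicator (ball 0 1) x) * ennreal (R / norm x)"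
      using assms by (simp add: nn_integral_cmult_indicator)
    also have "\<dots> = ennreal (real ?N * R) * indicator (ball 0 1) x"
      using x assms by (auto simp: ennreal_mult[symmetric] indicator_def)
    finally show ?thesis .
  qed
  have "(\<integral>\<^sup>+x. ennreal (?h x) \<partial>lborel) =
    (\<integral>\<^sup>+(x, s). ennreal (ray_weight x s) * ennreal (?h (s *\<^sub>R x)) \<partial>(lborel \<Otimes>\<^sub>M lborel))"
    by (rule nn_integral_rays) measurable
  also have "\<dots> = (\<integral>\<^sup>+x. (\<integral>\<^sup>+s. ennreal (ray_weight x s) * ennreal (?h (s *\<^sub>R x)) \<partial>lborel) \<partial>lborel)"
    by (subst lborel.nn_integral_fst[symmetric]) (auto simp: case_prod_beta)
  also have "\<dots> \<le> (\<integral>\<^sup>+x. ennreal (real ?N * R) * indicator (ball (0::'a) 1) x \<partial>lborel)"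
    using AE_lborel_singleton[of "0::'a"]
    by (intro nn_integral_mono_AE) (elim eventually_mono, use inner in auto)
  also have "\<dots> = ennreal (real ?N * R) * emeasure lborel (ball (0::'a) 1)"
    by (simp add: nn_integral_cmult_indicator)
  also have "\<dots> < \<infinity>"
    using emeasure_lborel_ball_finite[of "0::'a" 1] by (simp add: ennreal_mult_less_top)
  finally show "(\<integral>\<^sup>+x. ennreal (?h x) \<partial>lborel) < \<infinity>" .
qed

section \<open>Integration by parts and properties of test functions\<close>

text \<open>This bounds difference quotients by the supremum of the directional derivative, which
  provides the majorant for the limit below.\<close>

lemma directional_mvt:
  fixes \<Psi> :: "'a::real_normed_vector \<Rightarrow> real"
  assumes D: "\<And>x. (\<Psi> has_derivative D x) (at x)" and "0 < t"
  obtains \<xi> where "\<Psi> (x + t *\<^sub>R e) - \<Psi> x = t * D \<xi> e"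
proof -
  have der: "((\<lambda>s. \<Psi> (x + s *\<^sub>R e)) has_real_derivative D (x + s *\<^sub>R e) e) (at s)" for s
  proof -
    have "((\<lambda>s. \<Psi> (x + s *\<^sub>R e)) has_derivative (\<lambda>h. D (x + s *\<^sub>R e) (h *\<^sub>R e))) (at s)"
      by (rule has_derivative_compose[OF _ D]) (auto intro!: derivative_eq_intros)
    moreover have "D (x + s *\<^sub>R e) (h *\<^sub>R e) = D (x + s *\<^sub>R e) e * h" for h
      using has_derivative_linear[OF D[of "x + s *\<^sub>R e"]] by (simp add: linear_cmul)
    ultimately show ?thesis
      by (simp add: has_field_derivative_def)
  qed
  obtain z where "0 < z" "z < t" "\<Psi> (x + t *\<^sub>R e) - \<Psi> (x + 0 *\<^sub>R e) = (t - 0) * D (x + z *\<^sub>R e) e"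
    using MVT2[of 0 t "\<lambda>s. \<Psi> (x + s *\<^sub>R e)" "\<lambda>s. D (x + s *\<^sub>R e) e"] der assms(2) by blast
  then show ?thesis
    using that by simp
qed

text \<open>Translation invariance makes the integral of every difference quotient vanish.\<close>

lemma integral_directional_derivative_eq_0:
  fixes \<Psi> :: "'a::euclidean_space \<Rightarrow> real"
  assumes D: "\<And>x. (\<Psi> has_derivative D x) (at x)"
    and bound: "\<And>x. \<bar>D x e\<bar> \<le> L"
    and supp: "\<And>x. r \<le> norm x \<Longrightarrow> \<Psi> x = 0"
  shows "(\<integral>x. D x e \<partial>lborel) = 0"
proof -
  define t where "t n = 1 / real (Suc n)" for n
  define q where "q n x = (\<Psi> (x + t n *\<^sub>R e) - \<Psi> x) / t n" for n x
  have t: "0 < t n" "t n \<le> 1" for n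
    by (auto simp: t_def)
  have t0: "t \<longlonglongrightarrow> 0"
    unfolding t_def using LIMSEQ_inverse_real_of_nat by (simp add: inverse_eq_divide)
  have cont: "continuous_on UNIV \<Psi>"
    using D by (meson continuous_at_imp_continuous_on has_derivative_continuous)
  then have [measurable]: "\<Psi> \<in> borel_measurable borel"
    by (rule borel_measurable_continuous_onI)
  have L: "0 \<le> L"
    using bound[of 0] by linarith
  have int\<Psi>: "integrable lborel \<Psi>"
  proof -
    have "set_integrable lborel (cball 0 r) \<Psi>"
      unfolding set_integrable_def
      using cont by (intro borel_integrable_compact) (auto intro: continuous_on_subset)
    moreover have "(\<lambda>x. indicator (cball 0 r) x *\<^sub>R \<Psi> x) = \<Psi>"
      using supp by (auto simp: indicator_def fun_eq_iff)
    ultimately show ?thesis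
      by (simp add: set_integrable_def)
  qed
  have shift: "integrable lborel (\<lambda>x. \<Psi> (x + v))" "(\<integral>x. \<Psi> (x + v) \<partial>lborel) = (\<integral>x. \<Psi> x \<partial>lborel)" for v
  proof -
    have "lborel = distr lborel borel (\<lambda>x. v + x)"
      by (rule lborel_distr_plus[symmetric])
    then show "integrable lborel (\<lambda>x. \<Psi> (x + v))" "(\<integral>x. \<Psi> (x + v) \<partial>lborel) = (\<integral>x. \<Psi> x \<partial>lborel)"
      using int\<Psi> integrable_distr_eq[of "\<lambda>x. v + x" lborel borel \<Psi>]
        integral_distr[of "\<lambda>x. v + x" lborel borel \<Psi>]
      by (auto simp: add.commute)
  qed
  have conv: "(\<lambda>n. q n x) \<longlonglongrightarrow> D x e" for x
  proof -
    have "((\<lambda>s. \<Psi> (x + s *\<^sub>R e)) has_derivative (\<lambda>h. D (x + 0 *\<^sub>R e) (h *\<^sub>R e))) (at 0)"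
      by (rule has_derivative_compose[OF _ D]) (auto intro!: derivative_eq_intros)
    moreover have "D x (h *\<^sub>R e) = D x e * h" for h
      using has_derivative_linear[OF D[of x]] by (simp add: linear_cmul)
    ultimately have "((\<lambda>s. \<Psi> (x + s *\<^sub>R e)) has_real_derivative D x e) (at 0)"
      by (simp add: has_field_derivative_def)
    then have "((\<lambda>s. (\<Psi> (x + s *\<^sub>R e) - \<Psi> x) / s) \<longlongrightarrow> D x e) (at 0)"
      by (simp add: has_field_derivative_iff)
    moreover have "filterlim t (at 0) sequentially"
      using t0 t(1)[THEN less_imp_neq, symmetric] by (simp add: filterlim_at)
    ultimately show ?thesis
      unfolding q_def by (rule filterlim_compose)
  qed
  have "(\<lambda>n. \<integral>x. q n x \<partial>lborel) \<longlonglongrightarrow> (\<integral>x. D x e \<partial>lborel)"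
  proof (rule integral_dominated_convergence)
    show q_meas: "q n \<in> borel_measurable lborel" for n
      unfolding q_def by measurable
    \<comment> \<open>Continuity of the derivative is not assumed; measurability comes from the
      pointwise limit of the quotients.\<close>
    show "(\<lambda>x. D x e) \<in> borel_measurable lborel"
      by (rule borel_measurable_LIMSEQ_real[OF conv q_meas])
    show "AE x in lborel. (\<lambda>n. q n x) \<longlonglongrightarrow> D x e"
      using conv by simp
    \<comment> \<open>Since \<open>t n \<le> 1\<close>, the shift has length at most
      \<open>norm e\<close>, so every quotient vanishes outside the ball of radius
      \<open>r + norm e\<close>.\<close>
    show "integrable lborel (\<lambda>x. L * indicator (cball (0::'a) (r + norm e)) x)"
      by (intro integrable_mult_right integrable_real_indicator emeasure_lborel_cball_finite) auto
    show "AE x in lborel. norm (q n x) \<le> L * indicator (cball 0 (r + norm e)) x" for n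
    proof (rule AE_I2)
      fix x :: 'a
      show "norm (q n x) \<le> L * indicator (cball 0 (r + norm e)) x"
      proof (cases "norm x \<le> r + norm e")
        case True
        obtain \<xi> where "\<Psi> (x + t n *\<^sub>R e) - \<Psi> x = t n * D \<xi> e"
          using directional_mvt[OF D t(1)] by blast
        then have "q n x = D \<xi> e"
          using t(1)[of n] by (simp add: q_def)
        then show ?thesis
          using True bound by simp
      next
        case False
        have "norm (t n *\<^sub>R e) \<le> norm e"
          using t[of n] by (simp add: mult_left_le_one_le)
        then have "r \<le> norm (x + t n *\<^sub>R e)"
          using False norm_diff_ineq[of x "t n *\<^sub>R e"] by linarith
        moreover have "r \<le> norm x"
          using False norm_ge_zero[of e] by linarith
        ultimately show ?thesis
          using L supp by (simp add: q_def)
      qed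
    qed
  qed
  moreover have "(\<integral>x. q n x \<partial>lborel) = 0" for n
    unfolding q_def using shift int\<Psi> by simp
  ultimately show ?thesis
    by (simp add: LIMSEQ_const_iff)
qed

lemma test_function_has_derivative:
  assumes "\<phi> \<in> test_functions \<Omega>"
  shows "(\<phi> has_derivative (\<lambda>h. gradient \<phi> x \<bullet> h)) (at x)"
proof -
  have "times_cont_differentiable (Suc 0) \<phi>"
    using assms unfolding test_functions_def by blast
  then have D: "(\<phi> has_derivative frechet_derivative \<phi> (at x)) (at x)"
    by (simp add: frechet_derivative_works)
  have "frechet_derivative \<phi> (at x) h = gradient \<phi> x \<bullet> h" for h
  proof -
    have "frechet_derivative \<phi> (at x) h = frechet_derivative \<phi> (at x) (\<Sum>i\<in>Basis. (h \<bullet> i) *\<^sub>R i)"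
      by (simp add: euclidean_representation)
    also have "\<dots> = (\<Sum>i\<in>Basis. (h \<bullet> i) * frechet_derivative \<phi> (at x) i)"
      using has_derivative_linear[OF D] by (simp add: linear_sum linear_cmul)
    also have "\<dots> = (\<Sum>i\<in>Basis. frechet_derivative \<phi> (at x) i * (i \<bullet> h))"
      by (intro sum.cong) (auto simp: inner_commute)
    also have "\<dots> = gradient \<phi> x \<bullet> h"
      by (simp add: gradient_def partial_deriv_def inner_sum_left)
    finally show ?thesis .
  qed
  then have "frechet_derivative \<phi> (at x) = (\<lambda>h. gradient \<phi> x \<bullet> h)"
    by (rule ext)
  with D show ?thesis by simp
qed

lemma gradient_inner_Basis:
  "i \<in> Basis \<Longrightarrow> gradient \<phi> x \<bullet> i = partial_deriv i \<phi> x"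
  by (simp add: gradient_def inner_sum_left_Basis)

lemma test_function_continuous:
  assumes "\<phi> \<in> test_functions \<Omega>"
  shows "continuous_on UNIV \<phi>" "continuous_on UNIV (gradient \<phi>)"
proof -
  show "continuous_on UNIV \<phi>"
    using test_function_has_derivative[OF assms] has_derivative_continuous
    by (blast intro: continuous_at_imp_continuous_on)
  have "times_cont_differentiable (Suc 0) \<phi>"
    using assms unfolding test_functions_def by blast
  then show "continuous_on UNIV (gradient \<phi>)"
    unfolding gradient_def by (intro continuous_intros) simp
qed

text \<open>A compact support inside the open ball leaves a shell next to the sphere. Outside the
  support radius the function is locally zero, so its gradient vanishes there too.\<close>

lemma test_function_ball_bounds:
  fixes \<phi> :: "'a::euclidean_space \<Rightarrow> real"
  assumes \<phi>: "\<phi> \<in> test_functions (ball 0 R)" and R: "0 < R"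
  obtains r B where "0 < r" "r < R" "\<And>x. r \<le> norm x \<Longrightarrow> \<phi> x = 0" "\<And>x. r \<le> norm x \<Longrightarrow> gradient \<phi> x = 0"
    "\<And>x. \<bar>\<phi> x\<bar> \<le> B" "\<And>x. norm (gradient \<phi> x) \<le> B"
proof -
  define K where "K = closure {x. \<phi> x \<noteq> 0}"
  have K: "compact K" "K \<subseteq> ball 0 R"
    using \<phi> by (auto simp: K_def test_functions_def)
  have "\<exists>q<R. \<forall>x\<in>K. norm x \<le> q"
  proof (cases "K = {}")
    case False
    then obtain z where "z \<in> K" "\<forall>x\<in>K. norm x \<le> norm z"
      using continuous_attains_sup[OF K(1), of norm] by (auto intro: continuous_intros)
    then show ?thesis using K(2) by (intro exI[of _ "norm z"]) auto
  qed (use R in auto)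
  then obtain q where q: "q < R" "\<And>x. x \<in> K \<Longrightarrow> norm x \<le> q"
    by blast
  \<comment> \<open>Choosing \<open>r\<close> strictly above \<open>q\<close> gives vanishing
    already at \<open>norm x = r\<close>; the maximum with 0 makes \<open>r\<close> positive even if
    the support is empty.\<close>
  obtain r where r: "max 0 q < r" "r < R"
    using dense[of "max 0 q" R] q(1) R by auto
  have supp: "\<phi> x = 0" if "q < norm x" for x
    using q(2)[of x] that closure_subset[of "{x. \<phi> x \<noteq> 0}"] by (auto simp: K_def)
  have grad: "gradient \<phi> x = 0" if "q < norm x" for x
  proof -
    have "((\<lambda>_. 0) has_derivative (\<lambda>h. gradient \<phi> x \<bullet> h)) (at x)"
    proof (rule has_derivative_transform_within_open[OF test_function_has_derivative[OF \<phi>]])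
      show "open {x::'a. q < norm x}"
        by (intro open_Collect_less continuous_intros)
    qed (use that supp in auto)
    then have "(\<lambda>h. gradient \<phi> x \<bullet> h) = (\<lambda>_. 0)"
      by (rule has_derivative_unique) simp
    then have "gradient \<phi> x \<bullet> gradient \<phi> x = 0"
      by meson
    then show ?thesis by simp
  qed
  have bounded: "\<exists>B. \<forall>x. norm (\<psi> x) \<le> B" if "continuous_on UNIV \<psi>" "\<And>x. q < norm x \<Longrightarrow> \<psi> x = 0"
    for \<psi> :: "'a \<Rightarrow> 'b::real_normed_vector"
  proof -
    have "bounded (\<psi> ` cball 0 q)"
      using that(1) by (intro compact_imp_bounded compact_continuous_image) (auto intro: continuous_on_subset)
    then obtain B where "\<forall>y\<in>\<psi> ` cball 0 q. norm y \<le> B"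
      unfolding bounded_iff by blast
    then have "norm (\<psi> x) \<le> B" if "norm x \<le> q" for x
      using that by simp
    then have "norm (\<psi> x) \<le> max B 0" for x
      using that(2)[of x] by (cases "norm x \<le> q") (auto simp: le_max_iff_disj)
    then show ?thesis by blast
  qed
  obtain B1 B2 where B: "\<And>x. \<bar>\<phi> x\<bar> \<le> B1" "\<And>x. norm (gradient \<phi> x) \<le> B2"
    using bounded[OF test_function_continuous(1)[OF \<phi>] supp]
      bounded[OF test_function_continuous(2)[OF \<phi>] grad] by auto
  show ?thesis
  proof (rule that[of r "max B1 B2"])
    show "0 < r" "r < R" using r by auto
    show "\<phi> x = 0" if "r \<le> norm x" for x
      using that r by (intro supp) auto
    show "gradient \<phi> x = 0" if "r \<le> norm x" for x
      using that r by (intro grad) auto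
    show "\<bar>\<phi> x\<bar> \<le> max B1 B2" "norm (gradient \<phi> x) \<le> max B1 B2" for x
      using B[of x] by auto
  qed
qed

section \<open>Integrability by comparison with |x|^(1-N)\<close>

lemma set_integrable_ball_dominated:
  fixes h :: "'a::euclidean_space \<Rightarrow> real"
  assumes R: "0 < R" and [measurable]: "h \<in> borel_measurable borel"
    and bound: "\<And>x. x \<in> ball 0 R \<Longrightarrow> x \<noteq> 0 \<Longrightarrow> \<bar>h x\<bar> \<le> c / norm x ^ (DIM('a) - 1)"
  shows "set_integrable lborel (ball 0 R) h"
  unfolding set_integrable_def
proof (rule Bochner_Integration.integrable_bound)
  have [measurable]: "ball (0::'a) R \<in> sets borel" by simp
  show "integrable lborel (\<lambda>x::'a. c * (indicator (ball 0 R) x *\<^sub>R (1 / norm x ^ (DIM('a) - 1))))"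
    using integrable_inverse_norm_power[OF R] unfolding set_integrable_def
    by (rule integrable_mult_right)
  show "(\<lambda>x. indicat_real (ball 0 R) x *\<^sub>R h x) \<in> borel_measurable lborel"
    by measurable
  show "AE x in lborel. norm (indicat_real (ball 0 R) x *\<^sub>R h x) \<le>
      norm (c * (indicator (ball 0 R) x *\<^sub>R (1 / norm x ^ (DIM('a) - 1))))"
    using AE_lborel_singleton[of "0::'a"]
  proof eventually_elim
    case (elim x)
    have "c / norm x ^ (DIM('a) - 1) \<le> \<bar>c\<bar> / norm x ^ (DIM('a) - 1)"
      by (intro divide_right_mono) auto
    then show ?case
      using bound[OF _ elim] by (cases "x \<in> ball 0 R") (auto simp: abs_mult intro: order_trans)
  qed
qed

lemma locally_Lp_ballI:
  fixes h :: "'a::euclidean_space \<Rightarrow> 'b::euclidean_space"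
  assumes R: "0 < R" and h: "h \<in> borel_measurable borel"
    and bound: "\<And>x. x \<in> ball 0 R \<Longrightarrow> x \<noteq> 0 \<Longrightarrow> norm (h x) ^ p \<le> c / norm x ^ (DIM('a) - 1)"
  shows "locally_Lp p (ball 0 R) h"
  unfolding locally_Lp_def
proof (intro conjI allI impI)
  show "h \<in> borel_measurable (lebesgue_on (ball 0 R))"
    using h by (intro measurable_restrict_space1 measurable_completion) simp
  fix K :: "'a set" assume K: "compact K \<and> K \<subseteq> ball 0 R"
  have "set_integrable lborel (ball 0 R) (\<lambda>x. norm (h x) ^ p)"
    using h bound by (intro set_integrable_ball_dominated[OF R]) auto
  then have "set_integrable lborel K (\<lambda>x. norm (h x) ^ p)"
    by (rule set_integrable_subset) (use K in \<open>auto simp: compact_imp_closed\<close>)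
  then show "set_integrable lebesgue K (\<lambda>x. norm (h x) ^ p)"
    unfolding set_integrable_def by (subst integrable_completion) auto
qed

section \<open>The radial function is a distributional solution\<close>

text \<open>\<open>E\<close> carries the type \<open>'a\<close>, whose dimension enters the
  assumptions although the profiles are functions of a real variable. \<open>R < 1\<close> keeps
  powers of the norm decreasing in the exponent and the profile inside its interval of
  definition.\<close>

locale singular_profile =
  fixes f m U :: "real \<Rightarrow> real" and a C R :: real and E :: "'a::euclidean_space itself"
  assumes dim: "2 \<le> DIM('a)" and a: "0 < a" and R: "0 < R" "R < 1"
    and f_cont: "continuous_on {0..} f" and f_nonneg: "\<And>t. 0 \<le> t \<Longrightarrow> 0 \<le> f t"
    and f_le: "\<And>t. 0 \<le> t \<Longrightarrow> f t \<le> C * exp (t / a)"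
    and m_cont: "continuous_on {0..1} m" and m_0: "m 0 = a ^ (DIM('a) - 1)"
    and m_ge: "\<And>r. r \<in> {0..1} \<Longrightarrow> a ^ (DIM('a) - 1) \<le> m r"
    and m_le: "\<And>r. r \<in> {0..1} \<Longrightarrow> m r \<le> a ^ (DIM('a) - 1) + C"
    and m_deriv: "\<And>r. r \<in> {0<..<1} \<Longrightarrow> (m has_real_derivative r ^ (DIM('a) - 1) * f (max 0 (U r))) (at r)"
    and U_deriv: "\<And>r. r \<in> {0<..<1} \<Longrightarrow> (U has_real_derivative - root (DIM('a) - 1) (m r) / r) (at r)"
    and U_le: "\<And>r. r \<in> {0<..1} \<Longrightarrow> U r \<le> - a * ln r"
    and U_nonneg: "\<And>r. r \<in> {0<..<R} \<Longrightarrow> 0 \<le> U r"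
begin

text \<open>This is - r U'(r); unlike U' it stays bounded at the origin.\<close>

definition v :: "real \<Rightarrow> real" where
  "v r = root (DIM('a) - 1) (m r)"

definition V :: real where
  "V = root (DIM('a) - 1) (a ^ (DIM('a) - 1) + C)"

text \<open>The extension by 0 makes \<open>u\<close> Borel and nonnegative on the whole space, so
  \<open>f\<close> is never evaluated at a negative number.\<close>

definition u :: "'a \<Rightarrow> real" where
  "u x = indicator (ball 0 R - {0}) x *\<^sub>R U (norm x)"

text \<open>Away from the origin this is the classical gradient U'(|x|) x / |x| with U' = - v /
  r.\<close>

definition G :: "'a \<Rightarrow> 'a" where
  "G x = indicator (ball 0 R - {0}) x *\<^sub>R (- (v (norm x) / (norm x)\<^sup>2) *\<^sub>R x)"

lemma C_nonneg: "0 \<le> C"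
  using f_nonneg[of 0] f_le[of 0] by simp

lemma m_pos: "r \<in> {0..1} \<Longrightarrow> 0 < m r"
  using m_ge[of r] zero_less_power[OF a, of "DIM('a) - 1"] by linarith

lemma v_bounds: "r \<in> {0..1} \<Longrightarrow> 0 \<le> v r \<and> v r \<le> V"
  unfolding v_def V_def using dim m_pos[of r] m_le[of r] by (auto intro!: real_root_le_mono)

lemma V_nonneg: "0 \<le> V"
  using v_bounds[of 0] by auto

lemma U_continuous: "continuous_on {0<..<1} U"
  using U_deriv DERIV_isCont by (blast intro: continuous_at_imp_continuous_on)

lemma v_continuous: "continuous_on {0..1} v"
  unfolding v_def using dim m_cont by (intro continuous_on_real_root) auto

lemma ball_borel [measurable]: "ball 0 R \<in> sets (borel :: 'a measure)"
  by simp

lemma norm_continuous_on_punctured_ball: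
  assumes "continuous_on {0<..<1} h"
  shows "continuous_on (ball 0 R - {0}) (\<lambda>x::'a. h (norm x))"
  by (rule continuous_on_compose2[OF assms]) (use R in \<open>auto intro!: continuous_intros\<close>)

lemma u_borel [measurable]: "u \<in> borel_measurable borel"
  unfolding u_def
  by (intro borel_measurable_continuous_on_indicator norm_continuous_on_punctured_ball U_continuous)
    simp

lemma G_borel [measurable]: "G \<in> borel_measurable borel"
proof -
  have "continuous_on {0<..<1} v"
    by (rule continuous_on_subset[OF v_continuous]) auto
  then have "continuous_on (ball 0 R - {0}) (\<lambda>x::'a. v (norm x))"
    by (rule norm_continuous_on_punctured_ball)
  then show ?thesis
    unfolding G_def
    by (intro borel_measurable_continuous_on_indicator continuous_intros) auto
qed

lemma u_nonneg: "0 \<le> u x"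
  using U_nonneg[of "norm x"] by (auto simp: u_def indicator_def)

lemma f_u_borel [measurable]: "(\<lambda>x. f (u x)) \<in> borel_measurable borel"
proof -
  have "continuous_on UNIV (\<lambda>t. f (max 0 t))"
    by (rule continuous_on_compose2[OF f_cont]) (auto intro!: continuous_intros)
  then have "(\<lambda>t. f (max 0 t)) \<in> borel_measurable borel"
    by (rule borel_measurable_continuous_onI)
  from measurable_compose[OF u_borel this] show ?thesis
    using u_nonneg by (simp add: max_def)
qed

text \<open>A crude bound for the logarithm is enough: it puts \<open>u\<close> on the same scale 1
  / |x| as its gradient, so both have an integrable majorant.\<close>

lemma U_le_divide:
  assumes "r \<in> {0<..1}"
  shows "U r \<le> a / r"
proof -
  have "- ln r = ln (1 / r)"
    using assms by (simp add: ln_div)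
  also have "\<dots> \<le> 1 / r"
    using ln_le_minus_one[of "1 / r"] assms by simp
  finally have "a * - ln r \<le> a * (1 / r)"
    using a by (intro mult_left_mono) auto
  then show ?thesis
    using U_le[OF assms] by simp
qed

text \<open>The bound reaches beyond the ball because there u = 0 \<le> - a ln |x|. It is thus
  available on the sphere of radius \<open>R\<close>, which the local boundedness condition
  includes.\<close>

lemma f_u_le:
  assumes "x \<noteq> 0" "norm x \<le> 1"
  shows "\<bar>f (u x)\<bar> \<le> C / norm x"
proof -
  have "ln (norm x) \<le> 0" using assms by simp
  then have "a * ln (norm x) \<le> 0" using a by (simp add: mult_le_0_iff)
  then have "u x \<le> - a * ln (norm x)"
    using U_le[of "norm x"] assms by (auto simp: u_def indicator_def)
  then have *: "u x / a \<le> - ln (norm x)"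
    using a by (simp add: field_simps)
  have "f (u x) \<le> C * exp (u x / a)"
    by (intro f_le u_nonneg)
  also have "\<dots> \<le> C * exp (- ln (norm x))"
    using * C_nonneg by (intro mult_left_mono) auto
  also have "\<dots> = C / norm x"
    using assms by (simp add: exp_minus field_simps)
  finally show ?thesis
    using f_nonneg[OF u_nonneg] by simp
qed

lemma norm_G:
  assumes "x \<in> ball 0 R" "x \<noteq> 0"
  shows "norm (G x) = v (norm x) / norm x"
  using assms v_bounds[of "norm x"] R by (simp add: G_def power2_eq_square)

lemma inverse_norm_le:
  fixes x :: 'a
  assumes "x \<in> ball 0 R" "x \<noteq> 0" "0 \<le> c"
  shows "c / norm x \<le> c / norm x ^ (DIM('a) - 1)"
proof -
  have "norm x ^ (DIM('a) - 1) \<le> norm x ^ 1"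
    using assms R dim by (intro power_decreasing) auto
  then show ?thesis
    using assms by (intro divide_left_mono) auto
qed

lemma norm_G_le:
  assumes "x \<in> ball 0 R" "x \<noteq> 0"
  shows "norm (G x) \<le> V / norm x"
  using norm_G[OF assms] v_bounds[of "norm x"] R assms by (auto intro!: divide_right_mono)

text \<open>The power N - 1 removes the root in \<open>v\<close>; as \<open>m\<close> is bounded,
  the result has the integrable rate |x|^(1-N).\<close>

lemma norm_G_power:
  assumes "x \<in> ball 0 R" "x \<noteq> 0"
  shows "norm (G x) ^ (DIM('a) - 1) = m (norm x) / norm x ^ (DIM('a) - 1)"
  using assms R dim m_pos[of "norm x"] unfolding norm_G[OF assms] v_def
  by (simp add: power_divide real_root_pow_pos2 less_imp_le)

text \<open>The vector |G|^(N-2) G has length v^(N-1) / r^(N-1) = m / r^(N-1) and points inwards.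
  The nonlinear operator thereby becomes linear in \<open>m\<close>.\<close>

lemma flux:
  assumes "x \<in> ball 0 R" "x \<noteq> 0"
  shows "norm (G x) ^ (DIM('a) - 2) * (G x \<bullet> w) = - (m (norm x) / norm x ^ DIM('a)) * (x \<bullet> w)"
proof -
  define k where "k = DIM('a) - 2"
  have k: "DIM('a) = Suc (Suc k)" using dim by (simp add: k_def)
  have "v (norm x) ^ Suc k = m (norm x)"
    using m_pos[of "norm x"] assms R by (simp add: v_def k real_root_pow_pos2 less_imp_le del: power_Suc)
  then show ?thesis
    unfolding norm_G[OF assms] using assms
    by (simp add: G_def k field_simps power2_eq_square power_divide)
qed

lemma u_le:
  assumes "x \<in> ball 0 R" "x \<noteq> 0"
  shows "norm (u x) \<le> a / norm x"
  using U_le_divide[of "norm x"] U_nonneg[of "norm x"] assms R by (simp add: u_def)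

lemma locally_Linfty_f_u: "locally_Linfty (cball 0 R - {0}) (\<lambda>x. f (u x))"
  unfolding locally_Linfty_def
proof (intro conjI allI impI)
  show "(\<lambda>x. f (u x)) \<in> borel_measurable (lebesgue_on (cball 0 R - {0}))"
    by (intro measurable_restrict_space1 measurable_completion) simp
  fix K :: "'a set" assume K: "compact K \<and> K \<subseteq> cball 0 R - {0}"
  then obtain d where d: "0 < d" "\<And>x. x \<in> K \<Longrightarrow> d \<le> norm x"
    using separate_point_closed[of K 0] by (auto simp: compact_imp_closed)
  have "norm (f (u x)) \<le> C / d" if "x \<in> K" for x
  proof -
    have "x \<noteq> 0" "norm x \<le> 1"
      using that K R by force+
    then have "norm (f (u x)) \<le> C / norm x"
      using f_u_le[of x] by simp
    also have "\<dots> \<le> C / d"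
      using d(1) d(2)[OF that] C_nonneg \<open>x \<noteq> 0\<close> by (intro divide_left_mono mult_pos_pos) auto
    finally show ?thesis .
  qed
  then show "\<exists>M. AE x in lebesgue. x \<in> K \<longrightarrow> norm (f (u x)) \<le> M"
    by (intro exI[of _ "C / d"]) auto
qed

lemma locally_Lp_u: "locally_Lp 1 (ball 0 R) u"
proof (rule locally_Lp_ballI[OF R(1), where c = a])
  fix x :: 'a assume x: "x \<in> ball 0 R" "x \<noteq> 0"
  show "norm (u x) ^ 1 \<le> a / norm x ^ (DIM('a) - 1)"
    using u_le[OF x] inverse_norm_le[OF x, of a] a by simp
qed simp

lemma locally_Lp_G: "locally_Lp 1 (ball 0 R) G" "locally_Lp (DIM('a) - 1) (ball 0 R) G"
proof -
  show "locally_Lp 1 (ball 0 R) G"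
  proof (rule locally_Lp_ballI[OF R(1), where c = V])
    fix x :: 'a assume x: "x \<in> ball 0 R" "x \<noteq> 0"
    show "norm (G x) ^ 1 \<le> V / norm x ^ (DIM('a) - 1)"
      using norm_G_le[OF x] inverse_norm_le[OF x V_nonneg] by simp
  qed simp
  show "locally_Lp (DIM('a) - 1) (ball 0 R) G"
  proof (rule locally_Lp_ballI[OF R(1), where c = "a ^ (DIM('a) - 1) + C"])
    fix x :: 'a assume x: "x \<in> ball 0 R" "x \<noteq> 0"
    show "norm (G x) ^ (DIM('a) - 1) \<le> (a ^ (DIM('a) - 1) + C) / norm x ^ (DIM('a) - 1)"
      unfolding norm_G_power[OF x] using x R by (intro divide_right_mono m_le) auto
  qed simp
qed

lemma integrable_f_u:
  fixes \<phi> :: "'a \<Rightarrow> real"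
  assumes [measurable]: "\<phi> \<in> borel_measurable borel" and B: "\<And>x. \<bar>\<phi> x\<bar> \<le> B"
  shows "set_integrable lborel (ball 0 R) (\<lambda>x. f (u x) * \<phi> x)"
proof (rule set_integrable_ball_dominated[OF R(1), where c = "C * B"])
  fix x :: 'a assume x: "x \<in> ball 0 R" "x \<noteq> 0"
  have B0: "0 \<le> B" using B[of x] by linarith
  have "\<bar>f (u x) * \<phi> x\<bar> \<le> (C / norm x) * B"
    unfolding abs_mult using f_u_le[of x] B[of x] x R C_nonneg by (intro mult_mono) auto
  also have "\<dots> \<le> (C * B) / norm x ^ (DIM('a) - 1)"
    using inverse_norm_le[OF x, of "C * B"] B0 C_nonneg by simp
  finally show "\<bar>f (u x) * \<phi> x\<bar> \<le> (C * B) / norm x ^ (DIM('a) - 1)" .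
qed measurable

lemma gradient_borel:
  assumes "\<phi> \<in> test_functions (ball (0::'a) R)"
  shows "\<phi> \<in> borel_measurable borel" "gradient \<phi> \<in> borel_measurable borel"
  using test_function_continuous[OF assms] by (auto intro: borel_measurable_continuous_onI)

lemma integrable_flux:
  assumes \<phi>: "\<phi> \<in> test_functions (ball (0::'a) R)"
  shows "set_integrable lborel (ball 0 R) (\<lambda>x. norm (G x) ^ (DIM('a) - 2) * (G x \<bullet> gradient \<phi> x))"
proof -
  obtain B where B: "\<And>x. norm (gradient \<phi> x) \<le> B"
    using test_function_ball_bounds[OF \<phi> R(1)] by metis
  note [measurable] = gradient_borel[OF \<phi>]
  show ?thesis
  proof (rule set_integrable_ball_dominated[OF R(1), where c = "(a ^ (DIM('a) - 1) + C) * B"])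
    fix x :: 'a assume x: "x \<in> ball 0 R" "x \<noteq> 0"
    have B0: "0 \<le> B" using B[of x] norm_ge_zero[of "gradient \<phi> x"] by linarith
    have k: "DIM('a) - 1 = Suc (DIM('a) - 2)" using dim by simp
    have "\<bar>norm (G x) ^ (DIM('a) - 2) * (G x \<bullet> gradient \<phi> x)\<bar>
        \<le> norm (G x) ^ (DIM('a) - 2) * (norm (G x) * norm (gradient \<phi> x))"
      by (simp add: abs_mult mult_left_mono Cauchy_Schwarz_ineq2)
    also have "\<dots> = norm (G x) ^ (DIM('a) - 1) * norm (gradient \<phi> x)"
      by (simp only: k power_Suc mult_ac)
    also have "\<dots> \<le> (a ^ (DIM('a) - 1) + C) / norm x ^ (DIM('a) - 1) * B"
      unfolding norm_G_power[OF x]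
      using x R B[of x] B0 a C_nonneg by (intro mult_mono divide_right_mono m_le) auto
    finally show "\<bar>norm (G x) ^ (DIM('a) - 2) * (G x \<bullet> gradient \<phi> x)\<bar>
        \<le> (a ^ (DIM('a) - 1) + C) * B / norm x ^ (DIM('a) - 1)"
      by simp
  qed measurable
qed

text \<open>Along the ray through \<open>x\<close> the two sides of the equation combine into the derivative of
  \<open>s \<mapsto> m (s |x|) \<phi> (s x)\<close>, so that only the contribution \<open>m(0) \<phi>(0)\<close> of the singularity is left.\<close>

lemma ray_has_integral:
  fixes x :: 'a
  assumes \<phi>: "\<phi> \<in> test_functions (ball (0::'a) R)" and x: "x \<noteq> 0" "norm x < 1"
  defines "h \<equiv> \<lambda>y. indicator (ball 0 R) y *\<^sub>R
    (norm (G y) ^ (DIM('a) - 2) * (G y \<bullet> gradient \<phi> y) - f (u y) * \<phi> y)"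
  shows "((\<lambda>s. ray_weight x s * h (s *\<^sub>R x)) has_integral real DIM('a) * a ^ (DIM('a) - 1) * \<phi> 0) UNIV"
proof -
  let ?N = "DIM('a)"
  \<comment> \<open>The parameter at which the ray leaves the ball.\<close>
  define S where "S = R / norm x"
  define Q where "Q s = m (s * norm x) * \<phi> (s *\<^sub>R x)" for s
  define Q' where "Q' s = norm x * ((s * norm x) ^ (?N - 1) * f (max 0 (U (s * norm x)))) * \<phi> (s *\<^sub>R x)
      + m (s * norm x) * (gradient \<phi> (s *\<^sub>R x) \<bullet> x)" for s
  have S: "0 < S" and SR: "S * norm x = R"
    using R x by (auto simp: S_def)
  have lt: "s * norm x < R" if "s < S" for s
    using that x by (simp add: S_def field_simps)
  \<comment> \<open>The flux at s x carries the factor s / (s |x|)^N, which the ray weight cancels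
    up to \<open>N\<close>; in the source term the weight regroups as |x| (s |x|)^(N-1), the
    chain-rule form of m'.\<close>
  have ray: "ray_weight x s * h (s *\<^sub>R x) = - real ?N * Q' s" if s: "0 < s" "s < S" for s
  proof -
    let ?y = "s *\<^sub>R x"
    obtain k where k: "?N = Suc k"
      using dim by (cases ?N) auto
    have y: "?y \<in> ball 0 R" "?y \<noteq> 0"
      using lt[OF s(2)] s x by auto
    have uy: "u ?y = max 0 (U (s * norm x))"
      using y s U_nonneg[of "s * norm x"] lt[OF s(2)] x by (simp add: u_def)
    have flux_part: "real ?N * s ^ (?N - 1) * norm x ^ ?N * (norm (G ?y) ^ (?N - 2) * (G ?y \<bullet> gradient \<phi> ?y))
      = - real ?N * (m (s * norm x) * (gradient \<phi> ?y \<bullet> x))"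
      unfolding flux[OF y] using s x by (simp add: k field_simps power_mult_distrib inner_commute)
    have f_part: "real ?N * s ^ (?N - 1) * norm x ^ ?N * (f (u ?y) * \<phi> ?y)
      = real ?N * (norm x * ((s * norm x) ^ (?N - 1) * f (max 0 (U (s * norm x)))) * \<phi> ?y)"
      unfolding uy by (simp add: k power_mult_distrib)
    have "ray_weight x s * h ?y = real ?N * s ^ (?N - 1) * norm x ^ ?N * (norm (G ?y) ^ (?N - 2) * (G ?y \<bullet> gradient \<phi> ?y))
      - real ?N * s ^ (?N - 1) * norm x ^ ?N * (f (u ?y) * \<phi> ?y)"
      using y s x by (simp add: h_def ray_weight_def right_diff_distrib)
    then show ?thesis
      unfolding flux_part f_part by (simp add: Q'_def algebra_simps)
  qed
  have Q_cont: "continuous_on {0..S} Q"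
    unfolding Q_def
  proof (intro continuous_on_mult continuous_on_compose2[OF m_cont] continuous_on_compose2[OF test_function_continuous(1)[OF \<phi>]])
    have "s * norm x \<le> 1" if "s \<le> S" for s
      using mult_right_mono[OF that norm_ge_zero[of x]] SR R by linarith
    then show "(\<lambda>s. s * norm x) ` {0..S} \<subseteq> {0..1}"
      by auto
  qed (auto intro!: continuous_intros)
  have Q_deriv: "(Q has_vector_derivative Q' s) (at s)" if s: "s \<in> {0<..<S}" for s
  proof -
    have "(m has_real_derivative (s * norm x) ^ (?N - 1) * f (max 0 (U (s * norm x)))) (at (s * norm x))"
      using s x lt[of s] R by (intro m_deriv) auto
    moreover have "((\<lambda>s. s * norm x) has_real_derivative norm x) (at s)"
      by (auto intro!: derivative_eq_intros)
    ultimately have m: "((\<lambda>s. m (s * norm x)) has_real_derivative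
        (s * norm x) ^ (?N - 1) * f (max 0 (U (s * norm x))) * norm x) (at s)"
      by (rule DERIV_chain2)
    have "((\<lambda>s. \<phi> (s *\<^sub>R x)) has_derivative (\<lambda>h. gradient \<phi> (s *\<^sub>R x) \<bullet> (h *\<^sub>R x))) (at s)"
      by (rule has_derivative_compose[OF _ test_function_has_derivative[OF \<phi>]])
        (auto intro!: derivative_eq_intros)
    then have "((\<lambda>s. \<phi> (s *\<^sub>R x)) has_real_derivative gradient \<phi> (s *\<^sub>R x) \<bullet> x) (at s)"
      by (simp add: has_field_derivative_def mult_commute_abs)
    from DERIV_mult[OF m this] show ?thesis
      by (simp add: Q_def[abs_def] Q'_def has_real_derivative_iff_has_vector_derivative[symmetric] algebra_simps)
  qed
  obtain r where r: "r < R" "\<And>y. r \<le> norm y \<Longrightarrow> \<phi> y = 0"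
    using test_function_ball_bounds[OF \<phi> R(1)] by metis
  \<comment> \<open>The endpoint S x lies on the sphere of radius \<open>R\<close>, outside the
    support of \<phi>, so only the endpoint 0 contributes.\<close>
  have "Q S = 0"
    using r SR S by (simp add: Q_def)
  moreover have "Q 0 = a ^ (?N - 1) * \<phi> 0"
    by (simp add: Q_def m_0)
  ultimately have "(Q' has_integral - (a ^ (?N - 1) * \<phi> 0)) {0..S}"
    using fundamental_theorem_of_calculus_interior[OF _ Q_cont Q_deriv] S by simp
  then have "((\<lambda>s. - real ?N * Q' s) has_integral - real ?N * - (a ^ (?N - 1) * \<phi> 0)) {0..S}"
    by (rule has_integral_mult_right)
  then have "((\<lambda>s. - real ?N * Q' s) has_integral real ?N * a ^ (?N - 1) * \<phi> 0) {0<..<S}"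
    by (simp add: has_integral_Icc_iff_Ioo mult.assoc)
  then have "((\<lambda>s. ray_weight x s * h (s *\<^sub>R x)) has_integral real ?N * a ^ (?N - 1) * \<phi> 0) {0<..<S}"
    by (rule has_integral_eq[rotated]) (use ray in auto)
  then have "((\<lambda>s. if s \<in> {0<..<S} then ray_weight x s * h (s *\<^sub>R x) else 0)
      has_integral real ?N * a ^ (?N - 1) * \<phi> 0) UNIV"
    by (simp only: has_integral_restrict_UNIV)
  moreover have "(if s \<in> {0<..<S} then ray_weight x s * h (s *\<^sub>R x) else 0) = ray_weight x s * h (s *\<^sub>R x)" for s
    using x by (auto simp: ray_weight_def h_def S_def field_simps)
  ultimately show ?thesis
    by simp
qed

text \<open>Every direction contributes the same value, so averaging over the unit ball multiplies
  it by the volume of that ball. N times this volume is the area of the unit sphere: the mass is the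
  total flux a^(N-1) times this area through small spheres.\<close>

lemma weak_equation:
  assumes \<phi>: "\<phi> \<in> test_functions (ball (0::'a) R)"
  shows "(LINT x:ball 0 R|lebesgue. norm (G x) ^ (DIM('a) - 2) * (G x \<bullet> gradient \<phi> x)) =
     (LINT x:ball 0 R|lebesgue. f (u x) * \<phi> x) +
     real DIM('a) * a ^ (DIM('a) - 1) * measure lborel (ball (0::'a) 1) * \<phi> 0"
proof -
  note [measurable] = gradient_borel[OF \<phi>]
  let ?F = "\<lambda>x. norm (G x) ^ (DIM('a) - 2) * (G x \<bullet> gradient \<phi> x)"
  obtain B where B: "\<And>x. \<bar>\<phi> x\<bar> \<le> B"
    using test_function_ball_bounds[OF \<phi> R(1)] by metis
  note int = integrable_flux[OF \<phi>] integrable_f_u[OF gradient_borel(1)[OF \<phi>] B]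
  have "(LINT x:ball 0 R|lborel. ?F x) - (LINT x:ball 0 R|lborel. f (u x) * \<phi> x)
      = (LINT x:ball 0 R|lborel. ?F x - f (u x) * \<phi> x)"
    using int by (rule set_integral_diff(2)[symmetric])
  also have "\<dots> = real DIM('a) * a ^ (DIM('a) - 1) * \<phi> 0 * measure lborel (ball (0::'a) 1)"
    unfolding set_lebesgue_integral_def
    using set_integral_diff(1)[OF int] ray_has_integral[OF \<phi>]
    by (intro integral_rays_const) (auto simp: set_integrable_def)
  finally show ?thesis
    unfolding set_lebesgue_integral_def
    by (subst (1 2) integral_completion) (auto simp: algebra_simps)
qed

text \<open>The profile is regularised by evaluating it at \<open>sqrt (|x|\<^sup>2 + \<epsilon>\<^sup>2)\<close>, which removes the singularity
  at 0.\<close>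

lemma regularised_directional_derivative_integral_eq_0:
  fixes \<phi> :: "'a \<Rightarrow> real" and e :: 'a
  assumes \<phi>: "\<phi> \<in> test_functions (ball 0 R)"
    and r: "0 < r" "r < R" "\<And>x. r \<le> norm x \<Longrightarrow> \<phi> x = 0" "\<And>x. r \<le> norm x \<Longrightarrow> gradient \<phi> x = 0"
    and B: "\<And>x. \<bar>\<phi> x\<bar> \<le> B" "\<And>x. norm (gradient \<phi> x) \<le> B"
    and \<epsilon>: "0 < \<epsilon>" "r + \<epsilon> < R"
  defines "\<rho> \<equiv> \<lambda>x::'a. sqrt ((norm x)\<^sup>2 + \<epsilon>\<^sup>2)"
  defines "D \<equiv> \<lambda>x h. indicator (ball 0 r) x *\<^sub>R
    (U (\<rho> x) * (gradient \<phi> x \<bullet> h) - v (\<rho> x) / (\<rho> x)\<^sup>2 * (x \<bullet> h) * \<phi> x)"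
  shows "(\<integral>x. D x e \<partial>lborel) = 0" "\<And>x. \<bar>D x e\<bar> \<le> (a + V) * B * norm e / \<rho> x"
proof -
  have \<rho>_pos: "0 < \<rho> x" and \<rho>_ge: "norm x \<le> \<rho> x" "\<epsilon> \<le> \<rho> x" for x
    using \<epsilon> by (auto simp: \<rho>_def intro!: real_le_rsqrt sum_power2_gt_zero_iff[THEN iffD2] real_sqrt_gt_zero)
  have \<rho>_lt: "\<rho> x < R" if "norm x < r" for x
    using sqrt_sum_squares_le_sum[of "norm x" \<epsilon>] that \<epsilon> by (simp add: \<rho>_def)
  have B0: "0 \<le> B"
    using B(1)[of 0] by linarith
  \<comment> \<open>Keeping \<open>\<rho> x\<close> in the denominator instead of \<epsilon>
    matters: since \<open>norm x \<le> \<rho> x\<close>, it gives a majorant independent of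
    \<epsilon>.\<close>
  show bound: "\<bar>D x e\<bar> \<le> (a + V) * B * norm e / \<rho> x" for x
  proof (cases "norm x < r")
    case True
    have 1: "\<bar>U (\<rho> x)\<bar> \<le> a / \<rho> x"
      using U_le_divide[of "\<rho> x"] U_nonneg[of "\<rho> x"] \<rho>_pos[of x] \<rho>_lt[OF True] R by auto
    have "\<bar>U (\<rho> x) * (gradient \<phi> x \<bullet> e)\<bar> \<le> a / \<rho> x * (B * norm e)"
      unfolding abs_mult using a \<rho>_pos[of x]
      by (intro mult_mono 1 order_trans[OF Cauchy_Schwarz_ineq2] mult_right_mono B) auto
    moreover have "\<bar>v (\<rho> x) / (\<rho> x)\<^sup>2 * (x \<bullet> e) * \<phi> x\<bar> \<le> V / (\<rho> x)\<^sup>2 * (\<rho> x * norm e) * B"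
      unfolding abs_mult using v_bounds[of "\<rho> x"] \<rho>_pos[of x] \<rho>_lt[OF True] R V_nonneg
      by (intro mult_mono order_trans[OF Cauchy_Schwarz_ineq2] mult_right_mono B \<rho>_ge)
        (auto intro!: divide_right_mono)
    moreover have "V / (\<rho> x)\<^sup>2 * (\<rho> x * norm e) * B = V / \<rho> x * (B * norm e)"
      using \<rho>_pos[of x] by (simp add: power2_eq_square field_simps)
    ultimately have "\<bar>U (\<rho> x) * (gradient \<phi> x \<bullet> e) - v (\<rho> x) / (\<rho> x)\<^sup>2 * (x \<bullet> e) * \<phi> x\<bar>
        \<le> a / \<rho> x * (B * norm e) + V / \<rho> x * (B * norm e)"
      by linarith
    also have "\<dots> = (a + V) * B * norm e / \<rho> x"
      by (simp add: add_divide_distrib algebra_simps)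
    finally show ?thesis
      using True by (simp add: D_def)
  next
    case False
    then show ?thesis
      using a V_nonneg B0 \<rho>_pos[of x] by (simp add: D_def)
  qed
  \<comment> \<open>The explicit cut-off avoids values of \<open>U\<close> outside its interval; it
    agrees with the plain product because \<phi> vanishes from radius \<open>r\<close> on.\<close>
  define \<Psi> where "\<Psi> x = (if norm x < r then U (\<rho> x) * \<phi> x else 0)" for x
  have eq: "\<Psi> x = U (\<rho> x) * \<phi> x" for x
    using r(3)[of x] by (auto simp: \<Psi>_def)
  show "(\<integral>x. D x e \<partial>lborel) = 0"
  proof (rule integral_directional_derivative_eq_0)
    show "\<Psi> x = 0" if "r \<le> norm x" for x
      using that by (simp add: \<Psi>_def)
    show "\<bar>D x e\<bar> \<le> (a + V) * B * norm e / \<epsilon>" for x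
    proof -
      have "(a + V) * B * norm e / \<rho> x \<le> (a + V) * B * norm e / \<epsilon>"
        using a V_nonneg B0 \<epsilon> \<rho>_ge(2)[of x] by (intro divide_left_mono) (auto intro: mult_pos_pos)
      then show ?thesis using bound[of x] by linarith
    qed
    fix x
    \<comment> \<open>The regions |x| < q, where \<rho> < R and the chain rule applies, and |x| > r,
      where \<Psi> is zero, are open and overlap, so differentiability holds also at radius
      \<open>r\<close>.\<close>
    obtain q where q: "r < q" "q + \<epsilon> < R"
      using dense[of r "R - \<epsilon>"] \<epsilon> by (auto simp: field_simps)
    have \<phi>_deriv: "(\<phi> has_derivative (\<lambda>h. gradient \<phi> x \<bullet> h)) (at x)"
      by (rule test_function_has_derivative[OF \<phi>])
    show "(\<Psi> has_derivative D x) (at x)"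
    proof (cases "norm x < q")
      case True
      have "\<rho> x < R"
        using sqrt_sum_squares_le_sum[of "norm x" \<epsilon>] True \<epsilon> q by (simp add: \<rho>_def)
      then have U: "(U has_derivative (*) (- v (\<rho> x) / \<rho> x)) (at (\<rho> x))"
        using U_deriv[of "\<rho> x"] \<rho>_pos[of x] R by (simp add: v_def has_field_derivative_def)
      have "0 < x \<bullet> x + \<epsilon>\<^sup>2"
        using \<epsilon> by (simp add: add_nonneg_pos)
      then have "((\<lambda>x. sqrt (x \<bullet> x + \<epsilon>\<^sup>2)) has_derivative (\<lambda>h. (x \<bullet> h) / sqrt (x \<bullet> x + \<epsilon>\<^sup>2))) (at x)"
        by (auto intro!: derivative_eq_intros simp: inner_commute field_simps)
      then have "(\<rho> has_derivative (\<lambda>h. (x \<bullet> h) / \<rho> x)) (at x)"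
        by (simp add: \<rho>_def[abs_def] power2_norm_eq_inner)
      from has_derivative_mult[OF has_derivative_compose[OF this U] \<phi>_deriv]
      have "(\<Psi> has_derivative (\<lambda>h. U (\<rho> x) * (gradient \<phi> x \<bullet> h) + (- v (\<rho> x) / \<rho> x) * ((x \<bullet> h) / \<rho> x) * \<phi> x)) (at x)"
        by (simp add: eq[abs_def])
      moreover have "U (\<rho> x) * (gradient \<phi> x \<bullet> h) + (- v (\<rho> x) / \<rho> x) * ((x \<bullet> h) / \<rho> x) * \<phi> x = D x h" for h
        using r(3,4)[of x] by (cases "norm x < r") (auto simp: D_def power2_eq_square)
      ultimately show ?thesis
        by simp
    next
      case False
      have "D x = (\<lambda>_. 0)"
        using False q by (auto simp: D_def)
      moreover have "(\<Psi> has_derivative (\<lambda>_. 0)) (at x)"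
      proof (rule has_derivative_transform_within_open[OF has_derivative_const])
        show "open {x::'a. r < norm x}"
          by (intro open_Collect_less continuous_intros)
      qed (use False q in \<open>auto simp: \<Psi>_def\<close>)
      ultimately show ?thesis by simp
    qed
  qed
qed

text \<open>The regularised identities converge as \<epsilon> tends to 0 by dominated convergence,
  with a multiple of |x|^(1-N) as majorant.\<close>

lemma weak_gradient_identity:
  fixes \<phi> :: "'a \<Rightarrow> real" and i :: 'a
  assumes \<phi>: "\<phi> \<in> test_functions (ball 0 R)" and i: "i \<in> Basis"
  shows "(LINT x:ball 0 R|lebesgue. u x * partial_deriv i \<phi> x) = - (LINT x:ball 0 R|lebesgue. (G x \<bullet> i) * \<phi> x)"
proof -
  obtain r B where r: "0 < r" "r < R" "\<And>x. r \<le> norm x \<Longrightarrow> \<phi> x = 0" "\<And>x. r \<le> norm x \<Longrightarrow> gradient \<phi> x = 0"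
    and B: "\<And>x. \<bar>\<phi> x\<bar> \<le> B" "\<And>x. norm (gradient \<phi> x) \<le> B"
    using test_function_ball_bounds[OF \<phi> R(1)] by blast
  have B0: "0 \<le> B"
    using B(1)[of 0] by linarith
  note [measurable] = gradient_borel[OF \<phi>]
  \<comment> \<open>Denominators from 2 on ensure \<open>r + \<epsilon> n < R\<close> already for
    \<open>n = 0\<close>.\<close>
  define \<epsilon> where "\<epsilon> n = (R - r) / real (Suc (Suc n))" for n
  have \<epsilon>: "0 < \<epsilon> n" "r + \<epsilon> n < R" for n
  proof -
    have "(R - r) / real (Suc (Suc n)) < (R - r) / 1"
      using r by (intro divide_strict_left_mono) auto
    then show "0 < \<epsilon> n" "r + \<epsilon> n < R"
      using r by (auto simp: \<epsilon>_def)
  qed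
  have \<epsilon>0: "\<epsilon> \<longlonglongrightarrow> 0"
    unfolding \<epsilon>_def using LIMSEQ_ignore_initial_segment[OF lim_const_over_n[of "R - r"], of 2]
    by (simp add: numeral_2_eq_2)
  define \<rho> where "\<rho> n x = sqrt ((norm x)\<^sup>2 + (\<epsilon> n)\<^sup>2)" for n and x :: 'a
  define D where "D n x = indicator (ball 0 r) x *\<^sub>R
    (U (\<rho> n x) * (gradient \<phi> x \<bullet> i) - v (\<rho> n x) / (\<rho> n x)\<^sup>2 * (x \<bullet> i) * \<phi> x)" for n x
  \<comment> \<open>The limit is written on the full ball although \<open>D n\<close> is cut off at
    \<open>r\<close>: between these radii \<phi> and its gradient vanish.\<close>
  define D0 where "D0 x = indicator (ball 0 R) x *\<^sub>R (u x * (gradient \<phi> x \<bullet> i) + (G x \<bullet> i) * \<phi> x)" for x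
  note reg = regularised_directional_derivative_integral_eq_0[OF \<phi> r B \<epsilon>, where e = i, folded \<rho>_def, folded D_def]
  have "(\<lambda>n. \<integral>x. D n x \<partial>lborel) \<longlonglongrightarrow> (\<integral>x. D0 x \<partial>lborel)"
  proof (rule integral_dominated_convergence)
    show "D0 \<in> borel_measurable lborel"
      unfolding D0_def by measurable
    have \<rho>_borel: "\<rho> n \<in> borel_measurable borel" for n
      unfolding \<rho>_def by measurable
    show "D n \<in> borel_measurable lborel" for n
    proof -
      have \<rho>_cont: "continuous_on (ball 0 r) (\<rho> n)"
        unfolding \<rho>_def by (intro continuous_intros)
      have \<rho>_mem: "\<rho> n x \<in> {0<..<1}" if "x \<in> ball 0 r" for x
      proof -
        have "0 < \<rho> n x"
          using \<epsilon>[of n] by (simp add: \<rho>_def add_nonneg_pos)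
        moreover have "\<rho> n x \<le> norm x + \<epsilon> n"
          unfolding \<rho>_def using \<epsilon>(1)[of n] by (intro sqrt_sum_squares_le_sum) auto
        then have "\<rho> n x < 1"
          using that \<epsilon>[of n] R by simp
        ultimately show ?thesis by simp
      qed
      have "continuous_on (ball 0 r) (\<lambda>x. U (\<rho> n x))"
        by (rule continuous_on_compose2[OF U_continuous \<rho>_cont]) (use \<rho>_mem in auto)
      moreover have "continuous_on (ball 0 r) (\<lambda>x. v (\<rho> n x))"
        by (rule continuous_on_compose2[OF v_continuous \<rho>_cont]) (use \<rho>_mem in \<open>auto simp: less_imp_le\<close>)
      moreover have "\<rho> n x \<noteq> 0" if "x \<in> ball 0 r" for x
        using \<rho>_mem[OF that] by auto
      ultimately have "continuous_on (ball 0 r) (\<lambda>x. U (\<rho> n x) * (gradient \<phi> x \<bullet> i) - v (\<rho> n x) / (\<rho> n x)\<^sup>2 * (x \<bullet> i) * \<phi> x)"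
        using \<rho>_cont test_function_continuous[OF \<phi>]
        by (intro continuous_intros) (auto intro: continuous_on_subset)
      then have "D n \<in> borel_measurable borel"
        unfolding D_def by (intro borel_measurable_continuous_on_indicator) auto
      then show ?thesis
        by simp
    qed
    show "AE x in lborel. (\<lambda>n. D n x) \<longlonglongrightarrow> D0 x"
      using AE_lborel_singleton[of "0::'a"]
    proof eventually_elim
      case (elim x)
      show ?case
      proof (cases "norm x < r")
        case True
        have x: "0 < norm x" "norm x < 1"
          using elim True r R by auto
        have "(\<lambda>n. \<rho> n x) \<longlonglongrightarrow> sqrt ((norm x)\<^sup>2 + 0\<^sup>2)"
          unfolding \<rho>_def by (intro tendsto_intros \<epsilon>0)
        then have \<rho>: "(\<lambda>n. \<rho> n x) \<longlonglongrightarrow> norm x" by simp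
        have "isCont U (norm x)"
          using U_deriv[of "norm x"] x DERIV_isCont by auto
        moreover have "isCont v (norm x)"
          using continuous_on_interior[OF v_continuous, of "norm x"] x by simp
        ultimately have "(\<lambda>n. U (\<rho> n x)) \<longlonglongrightarrow> U (norm x)" "(\<lambda>n. v (\<rho> n x)) \<longlonglongrightarrow> v (norm x)"
          using \<rho> by (auto intro: isCont_tendsto_compose)
        then have "(\<lambda>n. U (\<rho> n x) * (gradient \<phi> x \<bullet> i) - v (\<rho> n x) / (\<rho> n x)\<^sup>2 * (x \<bullet> i) * \<phi> x)
          \<longlonglongrightarrow> U (norm x) * (gradient \<phi> x \<bullet> i) - v (norm x) / (norm x)\<^sup>2 * (x \<bullet> i) * \<phi> x"
          using x by (intro tendsto_intros \<rho>) auto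
        then show ?thesis
          using True r x by (simp add: D_def D0_def u_def G_def)
      next
        case False
        then have "D n x = 0" "D0 x = 0" for n
          using r(3,4)[of x] by (auto simp: D_def D0_def)
        then show ?thesis by simp
      qed
    qed
    show "integrable lborel (\<lambda>x::'a. indicator (ball 0 R) x *\<^sub>R ((a + V) * B / norm x ^ (DIM('a) - 1)))"
      using set_integrable_ball_dominated[OF R(1), of "\<lambda>x::'a. (a + V) * B / norm x ^ (DIM('a) - 1)" "(a + V) * B"]
        a V_nonneg B0 unfolding set_integrable_def by simp
    show "AE x in lborel. norm (D n x) \<le> indicator (ball 0 R) x *\<^sub>R ((a + V) * B / norm x ^ (DIM('a) - 1))" for n
      using AE_lborel_singleton[of "0::'a"]
    proof eventually_elim
      case (elim x)
      show ?case
      proof (cases "norm x < r")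
        case True
        have "norm (D n x) \<le> (a + V) * B / \<rho> n x"
          using reg(2)[of n x] i by simp
        also have "\<dots> \<le> (a + V) * B / norm x"
          using elim a V_nonneg B0 by (intro divide_left_mono) (auto simp: \<rho>_def intro!: real_le_rsqrt mult_pos_pos real_sqrt_gt_zero add_pos_nonneg)
        also have "\<dots> \<le> (a + V) * B / norm x ^ (DIM('a) - 1)"
          using True r elim a V_nonneg B0 by (intro inverse_norm_le) auto
        finally show ?thesis
          using True r by simp
      next
        case False
        then show ?thesis
          using a V_nonneg B0 by (simp add: D_def)
      qed
    qed
  qed
  then have D0: "(\<integral>x. D0 x \<partial>lborel) = 0"
    by (simp add: reg(1) LIMSEQ_const_iff)
  have int1: "set_integrable lborel (ball 0 R) (\<lambda>x. u x * (gradient \<phi> x \<bullet> i))"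
  proof (rule set_integrable_ball_dominated[OF R(1), where c = "a * B"])
    fix x :: 'a assume x: "x \<in> ball 0 R" "x \<noteq> 0"
    have "\<bar>gradient \<phi> x \<bullet> i\<bar> \<le> B"
      using Cauchy_Schwarz_ineq2[of "gradient \<phi> x" i] B(2)[of x] i by simp
    then have "\<bar>u x * (gradient \<phi> x \<bullet> i)\<bar> \<le> a / norm x * B"
      unfolding abs_mult using u_le[OF x] a by (intro mult_mono) auto
    then show "\<bar>u x * (gradient \<phi> x \<bullet> i)\<bar> \<le> a * B / norm x ^ (DIM('a) - 1)"
      using inverse_norm_le[OF x, of "a * B"] a B0 by simp
  qed measurable
  have int2: "set_integrable lborel (ball 0 R) (\<lambda>x. (G x \<bullet> i) * \<phi> x)"
  proof (rule set_integrable_ball_dominated[OF R(1), where c = "V * B"])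
    fix x :: 'a assume x: "x \<in> ball 0 R" "x \<noteq> 0"
    have "\<bar>G x \<bullet> i\<bar> \<le> V / norm x"
      using Cauchy_Schwarz_ineq2[of "G x" i] norm_G_le[OF x] i by simp
    then have "\<bar>(G x \<bullet> i) * \<phi> x\<bar> \<le> V / norm x * B"
      unfolding abs_mult using B(1)[of x] V_nonneg by (intro mult_mono) auto
    then show "\<bar>(G x \<bullet> i) * \<phi> x\<bar> \<le> V * B / norm x ^ (DIM('a) - 1)"
      using inverse_norm_le[OF x, of "V * B"] V_nonneg B0 by simp
  qed measurable
  have "(LINT x:ball 0 R|lborel. u x * (gradient \<phi> x \<bullet> i)) + (LINT x:ball 0 R|lborel. (G x \<bullet> i) * \<phi> x) = 0"
    using D0 set_integral_add(2)[OF int1 int2] by (simp add: D0_def set_lebesgue_integral_def)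
  then have "(LINT x:ball 0 R|lebesgue. u x * (gradient \<phi> x \<bullet> i)) = - (LINT x:ball 0 R|lebesgue. (G x \<bullet> i) * \<phi> x)"
    unfolding set_lebesgue_integral_def by (subst (1 2) integral_completion) auto
  then show ?thesis
    by (simp add: gradient_inner_Basis[OF i])
qed

theorem distributional_solution_u:
  "distributional_solution f (real DIM('a) * a ^ (DIM('a) - 1) * measure lborel (ball (0::'a) 1)) R u"
proof -
  have "set_integrable lborel (ball 0 R) (\<lambda>x. f (u x) * 1)"
    by (rule integrable_f_u[where B = 1]) auto
  then have "set_integrable lebesgue (ball 0 R) (\<lambda>x. f (u x))"
    unfolding set_integrable_def by (subst integrable_completion) auto
  then show ?thesis
    unfolding distributional_solution_def has_weak_gradient_def
    using u_nonneg locally_Linfty_f_u locally_Lp_u locally_Lp_G weak_gradient_identity weak_equation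
    by auto
qed

end

section \<open>Choice of the constants and conclusion\<close>

text \<open>A convergent sequence and its limit lie in one compact interval, on which a single
  Hoelder constant is available.\<close>

lemma locally_holder_on_imp_continuous_on:
  assumes "0 < \<theta>" "locally_holder_on \<theta> {0..} f"
  shows "continuous_on {0..} f"
  unfolding continuous_on_sequentially
proof (intro allI ballI impI)
  fix x :: "nat \<Rightarrow> real" and l
  assume l: "l \<in> {0..}" and x: "(\<forall>n. x n \<in> {0..}) \<and> x \<longlonglongrightarrow> l"
  then obtain K where K: "\<And>n. x n \<in> {0..K}"
    using Bseq_def[of x] convergentI[of x l] convergent_imp_Bseq[of x] by force
  have "l \<in> {0..K}"
    using x K l by (auto intro: LIMSEQ_le_const2)
  moreover obtain L where L: "\<And>s t. s \<in> {0..K} \<Longrightarrow> t \<in> {0..K} \<Longrightarrow> \<bar>f s - f t\<bar> \<le> L * \<bar>s - t\<bar> powr \<theta>"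
    using assms(2) compact_Icc[of 0 K] unfolding locally_holder_on_def by fastforce
  ultimately have "\<forall>n. norm (f (x n) - f l) \<le> L * \<bar>x n - l\<bar> powr \<theta>"
    using K by simp
  then have "\<forall>\<^sub>F n in sequentially. norm (f (x n) - f l) \<le> L * \<bar>x n - l\<bar> powr \<theta>"
    by (rule always_eventually)
  moreover have "(\<lambda>n. L * \<bar>x n - l\<bar> powr \<theta>) \<longlonglongrightarrow> 0"
  proof -
    have "(\<lambda>n. \<bar>x n - l\<bar>) \<longlonglongrightarrow> 0"
      using x by (simp add: LIM_zero tendsto_rabs_zero)
    then have "(\<lambda>n. \<bar>x n - l\<bar> powr \<theta>) \<longlonglongrightarrow> 0"
      by (rule tendsto_zero_powrI[OF _ tendsto_const _ assms(1)]) simp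
    then show ?thesis
      by (rule tendsto_mult_right_zero)
  qed
  ultimately have "(\<lambda>n. f (x n) - f l) \<longlonglongrightarrow> 0"
    by (rule Lim_null_comparison)
  then show "(f \<circ> x) \<longlonglongrightarrow> f l"
    by (simp add: o_def LIM_zero_cancel)
qed

theorem theorem3p1:
  fixes \<beta> C :: real
  assumes "DIM('a::euclidean_space) \<ge> 2" and "\<beta> > 0"
  shows "\<exists>\<alpha>>0. \<exists>R>0. \<forall>f.
    admissible_nonlinearity DIM('a) f \<longrightarrow>
    bdd_above ((\<lambda>t. f t * exp (- \<beta> * t)) ` {0..}) \<longrightarrow>
    C = (SUP t\<in>{0..}. f t * exp (- \<beta> * t)) \<longrightarrow>
    (\<exists>u :: 'a \<Rightarrow> real. distributional_solution f \<alpha> R u)"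
proof -
  let ?n = "DIM('a) - 1"
  define a where "a = 1 / \<beta>"
  \<comment> \<open>For r < R = exp (- K) and C \<ge> 0 the lower bound of the profile exceeds a K -
    C / a^(n-1) = a > 0, with n = N - 1. The summand 1 also gives R < 1. The absolute value is taken
    because the constants are fixed before any \<open>f\<close>, when the sign of \<open>C\<close>
    is still unknown.\<close>
  define K where "K = \<bar>C\<bar> / a ^ ?n + 1"
  define \<alpha> where "\<alpha> = real DIM('a) * a ^ ?n * measure lborel (ball (0::'a) 1)"
  define R where "R = exp (- K)"
  have a: "0 < a" and n: "0 < ?n"
    using assms by (auto simp: a_def)
  have K: "0 < K"
    using a by (auto simp: K_def add_nonneg_pos)
  have R: "0 < R" "R < 1"
    using K by (auto simp: R_def)
  have \<alpha>: "0 < \<alpha>"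
    using a content_ball_pos[of 1 "0::'a"] by (simp add: \<alpha>_def)
  have "\<exists>u :: 'a \<Rightarrow> real. distributional_solution f \<alpha> R u"
    if adm: "admissible_nonlinearity DIM('a) f"
      and bdd: "bdd_above ((\<lambda>t. f t * exp (- \<beta> * t)) ` {0..})"
      and C: "C = (SUP t\<in>{0..}. f t * exp (- \<beta> * t))" for f
  proof -
    have nonneg: "0 \<le> f t" if "0 \<le> t" for t
      using adm that unfolding admissible_nonlinearity_def by auto
    have le: "f t \<le> C * exp (t / a)" if "0 \<le> t" for t
    proof -
      have "f t * exp (- \<beta> * t) \<le> C"
        unfolding C using that by (intro cSUP_upper bdd) auto
      then have "f t * exp (- \<beta> * t) * exp (\<beta> * t) \<le> C * exp (\<beta> * t)"
        by (intro mult_right_mono) auto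
      then show ?thesis
        by (simp add: a_def mult.commute exp_minus field_simps)
    qed
    have C_nonneg: "0 \<le> C"
      using nonneg[of 0] le[of 0] by simp
    have cont: "continuous_on {0..} f"
      using adm locally_holder_on_imp_continuous_on unfolding admissible_nonlinearity_def by blast
    obtain m U where mU:
      "continuous_on {0..1} m" "m 0 = a ^ ?n"
      "\<And>r. r \<in> {0..1} \<Longrightarrow> a ^ ?n \<le> m r"
      "\<And>r. r \<in> {0..1} \<Longrightarrow> m r \<le> a ^ ?n + C"
      "\<And>r. r \<in> {0<..<1} \<Longrightarrow> (m has_real_derivative r ^ ?n * f (max 0 (U r))) (at r)"
      "\<And>r. r \<in> {0<..<1} \<Longrightarrow> (U has_real_derivative - root ?n (m r) / r) (at r)"
      "\<And>r. r \<in> {0<..1} \<Longrightarrow> U r \<le> - a * ln r"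
      "\<And>r. r \<in> {0<..1} \<Longrightarrow> - a * ln r - C / a ^ (?n - 1) * r \<le> U r"
      using exists_radial_profile[OF n a cont nonneg le] by blast
    have U_nonneg: "0 \<le> U r" if r: "r \<in> {0<..<R}" for r
    proof -
      define c where "c = C / a ^ (?n - 1)"
      have "a ^ ?n = a * a ^ (?n - 1)"
        using n by (metis Suc_diff_1 power_Suc)
      then have c: "0 \<le> c" "a * K = c + a"
        using a C_nonneg by (simp_all add: c_def K_def distrib_left del: One_nat_def)
      have "ln r < - K"
        using r ln_less_cancel_iff[of r R] R by (simp add: R_def)
      then have "a * K \<le> - a * ln r"
        using a mult_left_mono[of K "- ln r" a] by simp
      moreover have "c * r \<le> c"
        using c r R by (intro mult_left_le) auto
      ultimately show ?thesis
        using mU(8)[of r] r R a c by (simp add: c_def)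
    qed
    interpret singular_profile f m U a C R "TYPE('a)"
      by unfold_locales (use assms(1) a R cont nonneg le mU U_nonneg in auto)
    show ?thesis
      using distributional_solution_u unfolding \<alpha>_def by blast
  qed
  then show ?thesis
    using \<alpha> R by blast
qed

end
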